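(* There are absolute constants $\varepsilon,\delta>0$ such that any $+n^{\delta}$-additive $3$-FT distance sensitivity oracle for a single pair $(s,t)$ in $n$-node undirected unweighted graphs uses $\Omega(n^{1+\varepsilon})$ bits of space in the worst case.
   Context: A $+\beta$-additive $f$-FT distance sensitivity oracle for a pair $(s,t)$ of a graph $G=(V,E)$ is a data structure (of arbitrary form) built from $G$ that, given any fault set $F\subseteq E$ with $|F|\leq f$, returns a value $\tilde d$ with $\mathrm{dist}_{G\setminus F}(s,t)\leq \tilde d\leq \mathrm{dist}_{G\setminus F}(s,t)+\beta$. The space bound means that over the class of $n$-node undirected unweighted graphs (with a designated pair), some graph requires a representation of $\Omega(n^{1+\varepsilon})$ bits. *)

theory Defs
  imports Complex_Main "HOL-Library.Landau_Symbols" "HOL-Library.Extended_Real"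
begin

text \<open>Simple undirected graphs on the vertex set \<open>{..<n}\<close>, given by their edge sets.\<close>

definition graphs :: "nat \<Rightarrow> nat set set set" where
  "graphs n = {E. \<forall>e\<in>E. \<exists>u<n. \<exists>v<n. u \<noteq> v \<and> e = {u, v}}"

text \<open>The \<open>k\<close>-th relational power of adjacency relates the endpoints of walks with \<open>k\<close> edges.
  The distance of two disconnected vertices is \<open>\<infinity>\<close>, the infimum of the empty set.\<close>

definition adj :: "'a set set \<Rightarrow> ('a \<times> 'a) set" where
  "adj E = {(u, v). {u, v} \<in> E}"

definition graph_dist :: "'a set set \<Rightarrow> 'a \<Rightarrow> 'a \<Rightarrow> enat" where
  "graph_dist E s t = (INF k \<in> {k. (s, t) \<in> adj E ^^ k}. enat k)"

text \<open>A distance sensitivity data structure consists of an arbitrary preprocessing function, whose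
  output is what is stored, and an arbitrary query function. The query function does not see the
  graph, but it may use the designated pair without that pair being charged to the space.\<close>

record ft_dso =
  build :: "nat set set \<Rightarrow> nat \<Rightarrow> nat \<Rightarrow> bool list"
  query :: "bool list \<Rightarrow> nat \<Rightarrow> nat \<Rightarrow> nat set set \<Rightarrow> ereal"

definition additive_FT_DSO :: "nat \<Rightarrow> nat \<Rightarrow> real \<Rightarrow> ft_dso \<Rightarrow> bool" where
  "additive_FT_DSO n f \<beta> D \<longleftrightarrow>
     (\<forall>E\<in>graphs n. \<forall>s<n. \<forall>t<n. \<forall>F. F \<subseteq> E \<and> card F \<le> f \<longrightarrow>
        ereal_of_enat (graph_dist (E - F) s t) \<le> query D (build D E s t) s t F \<and>
        query D (build D E s t) s t F \<le> ereal_of_enat (graph_dist (E - F) s t) + ereal \<beta>)"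

text \<open>Only finitely many instances exist for each \<open>n\<close>, so the supremum is a maximum
  (and \<open>0\<close> for \<open>n = 0\<close>, where there is no instance).\<close>

definition worst_case_bits :: "nat \<Rightarrow> ft_dso \<Rightarrow> nat" where
  "worst_case_bits n D =
     (SUP (E, s, t) \<in> graphs n \<times> {..<n} \<times> {..<n}. length (build D E s t))"

end

theory Submission
  imports Defs "HOL-Library.FuncSet" "HOL-Library.Numeral_Type"
begin

text \<open>A family of graphs is indexed by the subsets \<open>J\<close> of a set \<open>I\<close> of more than \<open>n^(1+\<epsilon>)\<close> paths in a
  layered graph. Each path \<open>\<pi>\<close> is the unique shortest path between its ends, and no other path makes
  the same turn (pair of consecutive edges). Every node is blown up into the bipartite graph of its
  turns, with the turns of \<open>\<pi>\<close> omitted unless \<open>\<pi> \<in> J\<close>. So the ends of \<open>\<pi>\<close> are at a fixed distance if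
  \<open>\<pi> \<in> J\<close> and farther by twice the number of inner nodes otherwise. A comb attached to the starts lets
  one fault select the start from \<open>s\<close>, and combs attached to the leaves of a comb let two faults
  select the end from \<open>t\<close>. The oracle therefore determines \<open>J\<close>, which takes \<open>card I\<close> bits.

  One fault selects among \<open>n^(1/2)\<close> starts and two faults among \<open>n^(2/3)\<close> ends, up to
  small powers of \<open>n\<close>, which leaves room for nearly \<open>n^(7/6)\<close> paths. Distances are bounded below by
  potentials, that is 1-Lipschitz functions on the vertices.\<close>

section \<open>Distances and encodings\<close>

definition potential :: "'a set set \<Rightarrow> ('a \<Rightarrow> int) \<Rightarrow> bool" where
  "potential E \<phi> \<longleftrightarrow> (\<forall>u v. {u, v} \<in> E \<longrightarrow> \<phi> u \<le> \<phi> v + 1)"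

lemma potentialI:
  assumes "\<And>e. e \<in> E \<Longrightarrow> \<exists>u v. e = {u, v} \<and> \<bar>\<phi> u - \<phi> v\<bar> \<le> 1"
  shows "potential E \<phi>"
  unfolding potential_def
proof (intro allI impI)
  fix u v assume "{u, v} \<in> E"
  from assms[OF this] obtain a b where "{u, v} = {a, b}" "\<bar>\<phi> a - \<phi> b\<bar> \<le> 1" by blast
  then show "\<phi> u \<le> \<phi> v + 1" by (auto simp: doubleton_eq_iff)
qed

lemma potentialD: "potential E \<phi> \<Longrightarrow> {u, v} \<in> E \<Longrightarrow> \<bar>\<phi> u - \<phi> v\<bar> \<le> 1"
  unfolding potential_def by (smt (verit) insert_commute)

lemma potential_walk:
  assumes "potential E \<phi>" "(s, t) \<in> adj E ^^ k"
  shows "\<phi> t \<le> \<phi> s + int k"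
  using assms(2)
proof (induction k arbitrary: t)
  case (Suc k)
  then obtain w where "(s, w) \<in> adj E ^^ k" "{w, t} \<in> E"
    by (auto simp: adj_def)
  moreover have "\<phi> t \<le> \<phi> w + 1"
    using assms(1) \<open>{w, t} \<in> E\<close> unfolding potential_def by (metis insert_commute)
  ultimately show ?case using Suc.IH by fastforce
qed simp

lemma graph_dist_ge:
  assumes "potential E \<phi>" "\<phi> s + int N \<le> \<phi> t"
  shows "enat N \<le> graph_dist E s t"
  unfolding graph_dist_def
  by (rule INF_greatest) (use potential_walk[OF assms(1)] assms(2) in fastforce)

lemma graph_dist_le: "(s, t) \<in> adj E ^^ k \<Longrightarrow> graph_dist E s t \<le> enat k"
  unfolding graph_dist_def by (rule INF_lower) simp

lemma sym_adj: "sym (adj E)"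
  by (auto simp: adj_def sym_def insert_commute)

lemma walk_rev: "(s, t) \<in> adj E ^^ k \<Longrightarrow> (t, s) \<in> adj E ^^ k"
proof (induction k arbitrary: t)
  case (Suc k)
  then obtain w where "(s, w) \<in> adj E ^^ k" "(w, t) \<in> adj E" by auto
  with Suc.IH show ?case by (metis relpow_Suc_I2 sym_adj symD)
qed simp

lemma walk_trans: "(s, t) \<in> R ^^ k \<Longrightarrow> (t, u) \<in> R ^^ m \<Longrightarrow> (s, u) \<in> R ^^ (k + m)"
  by (auto simp: relpow_add)

lemma walk_step: "(s, t) \<in> R ^^ k \<Longrightarrow> (t, u) \<in> R \<Longrightarrow> (s, u) \<in> R ^^ Suc k"
  by auto

lemma walk_fun: "(\<And>j. j < k \<Longrightarrow> (f j, f (Suc j)) \<in> R) \<Longrightarrow> (f 0, f k) \<in> R ^^ k"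
  by (auto simp: relpow_fun_conv)

lemma walk_image:
  assumes "(s, t) \<in> adj E ^^ k" "(`) g ` E \<subseteq> E'"
  shows "(g s, g t) \<in> adj E' ^^ k"
  using assms(1)
proof (induction k arbitrary: t)
  case (Suc k)
  then obtain w where w: "(s, w) \<in> adj E ^^ k" "{w, t} \<in> E"
    by (auto simp: adj_def)
  have "g ` {w, t} \<in> E'" using w(2) assms(2) by blast
  then have "(g w, g t) \<in> adj E'" by (simp add: adj_def)
  with Suc.IH[OF w(1)] show ?case by auto
qed simp

lemma potential_image:
  assumes "inj_on g A" "\<Union>E \<subseteq> A" "potential E \<phi>"
  shows "potential ((`) g ` E) (\<phi> \<circ> inv_into A g)"
  unfolding potential_def
proof (intro allI impI)
  fix u v assume "{u, v} \<in> (`) g ` E"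
  then obtain e where e: "e \<in> E" "{u, v} = g ` e" by auto
  then obtain a b where ab: "a \<in> e" "b \<in> e" "u = g a" "v = g b" by blast
  have "e \<subseteq> A" using e assms(2) by auto
  moreover have "g ` e = g ` {a, b}" using e ab by auto
  ultimately have "e = {a, b}"
    using assms(1) ab by (metis inj_on_image_eq_iff insert_subset empty_subsetI subsetD)
  with e ab assms \<open>e \<subseteq> A\<close> show "(\<phi> \<circ> inv_into A g) u \<le> (\<phi> \<circ> inv_into A g) v + 1"
    by (auto simp: potential_def subset_iff)
qed

section \<open>Recovering a subset from the stored bits\<close>

lemma finite_graphs: "finite (graphs n)"
proof (rule finite_subset)
  show "graphs n \<subseteq> Pow (Pow {..<n})" by (fastforce simp: graphs_def)
qed simp

lemma length_le_worst_case_bits: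
  assumes "E \<in> graphs n" "s < n" "t < n"
  shows "length (build D E s t) \<le> worst_case_bits n D"
proof -
  have "finite (graphs n \<times> {..<n} \<times> {..<n})" by (simp add: finite_graphs)
  then have "(\<lambda>(E, s, t). length (build D E s t)) (E, s, t) \<le> worst_case_bits n D"
    unfolding worst_case_bits_def using assms
    by (intro cSUP_upper bdd_above_finite finite_imageI) auto
  then show ?thesis by simp
qed

text \<open>There are \<open>2 ^ Suc W - 1\<close> bit lists of length up to \<open>W\<close>; being
  strictly below \<open>2 ^ Suc W\<close> is what gives \<open>W\<close> and not
  \<open>W + 1\<close>.\<close>

lemma card_le_if_inj_bool_lists:
  assumes "inj_on c (Pow I)" "finite I" "\<And>J. J \<subseteq> I \<Longrightarrow> length (c J :: bool list) \<le> W"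
  shows "card I \<le> W"
proof -
  let ?L = "{xs :: bool list. set xs \<subseteq> UNIV \<and> length xs \<le> W}"
  have "2 ^ card I = card (Pow I)" using assms(2) by (simp add: card_Pow)
  also have "\<dots> \<le> card ?L"
    by (rule card_inj_on_le[OF assms(1)]) (use assms(3) finite_lists_length_le[of "UNIV :: bool set" W] in auto)
  also have "\<dots> = (\<Sum>i\<le>W. 2 ^ i)"
    using card_lists_length_le[of "UNIV :: bool set" W] by simp
  also have "\<dots> = 2 ^ Suc W - (1 :: nat)"
    by (metis atLeast0LessThan lessThan_Suc_atMost sum_power2)
  also have "\<dots> < 2 ^ Suc W" by simp
  finally show ?thesis by (simp add: power_strict_increasing_iff del: power_Suc)
qed

text \<open>Reduces the bound to a graph construction. In \<open>sep\<close> the faults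
  \<open>F\<close> and the threshold \<open>T\<close> are chosen before \<open>J\<close>, so a
  single query tests membership of \<open>\<pi>\<close> in whichever \<open>J\<close> was stored,
  and \<open>gap\<close> exceeds the additive error.\<close>

lemma card_le_worst_case_bits:
  fixes E :: "'i set \<Rightarrow> 'a set set" and A :: "'a set"
  assumes D: "additive_FT_DSO n f \<beta> D" and "\<beta> < real gap"
    and A: "finite A" "card A \<le> n" "s \<in> A" "t \<in> A"
    and E: "\<And>J e. J \<subseteq> I \<Longrightarrow> e \<in> E J \<Longrightarrow> \<exists>u\<in>A. \<exists>v\<in>A. u \<noteq> v \<and> e = {u, v}"
    and "finite I"
    and sep: "\<And>\<pi>. \<pi> \<in> I \<Longrightarrow> \<exists>F T. card F \<le> f \<and> finite F \<and> (\<forall>J\<subseteq>I. F \<subseteq> E J \<and>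
        (\<pi> \<in> J \<longrightarrow> (s, t) \<in> adj (E J - F) ^^ T) \<and>
        (\<pi> \<notin> J \<longrightarrow> (\<exists>\<phi>. potential (E J - F) \<phi> \<and> \<phi> s + int (T + gap) \<le> \<phi> t)))"
  shows "card I \<le> worst_case_bits n D"
proof -
  \<comment> \<open>Numbers below \<open>n\<close> outside the image of \<open>g\<close> become
    isolated vertices.\<close>
  obtain g :: "'a \<Rightarrow> nat" where g: "inj_on g A" "g ` A \<subseteq> {..<n}"
    using A by (metis card_le_inj card_lessThan finite_lessThan)
  let ?G = "\<lambda>J. (`) g ` E J"
  have sub: "\<Union>(E J) \<subseteq> A" if "J \<subseteq> I" for J using E[OF that] by fastforce
  have G: "?G J \<in> graphs n" if "J \<subseteq> I" for J
    unfolding graphs_def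
  proof safe
    fix e assume "e \<in> E J"
    from E[OF \<open>J \<subseteq> I\<close> this] obtain u v where "u \<in> A" "v \<in> A" "u \<noteq> v" "e = {u, v}" by metis
    then have "g u < n" "g v < n" "g u \<noteq> g v" "g ` e = {g u, g v}"
      using g by (auto simp: inj_on_eq_iff)
    then show "\<exists>u<n. \<exists>v<n. u \<noteq> v \<and> g ` e = {u, v}" by blast
  qed
  have st: "g s < n" "g t < n" using A g by auto
  let ?c = "\<lambda>J. build D (?G J) (g s) (g t)"
  \<comment> \<open>Equal strings give the same answer to the query for \<open>\<pi>\<close>, which
    would be at most \<open>T + \<beta>\<close> and at least \<open>T + gap\<close>.\<close>
  have contra: False if J: "J \<subseteq> I" "J' \<subseteq> I" and \<pi>: "\<pi> \<in> J" "\<pi> \<notin> J'" and eq: "?c J = ?c J'" for J J' \<pi>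
  proof -
    have "\<pi> \<in> I" using J \<pi> by blast
    from sep[OF this] obtain F T where "card F \<le> f" "finite F" and
      *: "\<And>J. J \<subseteq> I \<Longrightarrow> F \<subseteq> E J \<and> (\<pi> \<in> J \<longrightarrow> (s, t) \<in> adj (E J - F) ^^ T) \<and>
        (\<pi> \<notin> J \<longrightarrow> (\<exists>\<phi>. potential (E J - F) \<phi> \<and> \<phi> s + int (T + gap) \<le> \<phi> t))"
      by blast
    then have F: "card F \<le> f" "finite F" "F \<subseteq> E J" "F \<subseteq> E J'"
      and up: "(s, t) \<in> adj (E J - F) ^^ T"
      and lo: "\<exists>\<phi>. potential (E J' - F) \<phi> \<and> \<phi> s + int (T + gap) \<le> \<phi> t"
      using *[OF J(1)] *[OF J(2)] \<pi> by simp_all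
    let ?F = "(`) g ` F"
    have diff: "?G J - ?F = (`) g ` (E J - F)" if "J \<subseteq> I" "F \<subseteq> E J" for J
    proof -
      have "inj_on ((`) g) (E J)"
        by (rule inj_on_subset[OF inj_on_image_Pow[OF g(1)]]) (use sub[OF that(1)] in auto)
      then show ?thesis using that by (metis inj_on_image_set_diff order_refl Diff_subset)
    qed
    have answer: "ereal_of_enat (graph_dist (?G J - ?F) (g s) (g t)) \<le> query D (?c J) (g s) (g t) ?F \<and>
        query D (?c J) (g s) (g t) ?F \<le> ereal_of_enat (graph_dist (?G J - ?F) (g s) (g t)) + ereal \<beta>"
      if "J \<subseteq> I" "F \<subseteq> E J" for J
    proof -
      have "?F \<subseteq> ?G J" using that(2) by blast
      moreover have "card ?F \<le> f" using F card_image_le[of F "(`) g"] by linarith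
      ultimately show ?thesis
        using D[unfolded additive_FT_DSO_def, rule_format, OF G[OF that(1)] st, of ?F] by simp
    qed
    let ?q = "query D (?c J) (g s) (g t) ?F"
    have "graph_dist (?G J - ?F) (g s) (g t) \<le> enat T"
      unfolding diff[OF J(1) F(3)] by (rule graph_dist_le[OF walk_image[OF up order_refl]])
    then have 1: "ereal_of_enat (graph_dist (?G J - ?F) (g s) (g t)) \<le> ereal (real T)"
      by (metis ereal_of_enat_le_iff ereal_of_enat_simps(1))
    obtain \<phi> where \<phi>: "potential (E J' - F) \<phi>" "\<phi> s + int (T + gap) \<le> \<phi> t" using lo by auto
    have "potential ((`) g ` (E J' - F)) (\<phi> \<circ> inv_into A g)"
      by (rule potential_image[OF g(1) _ \<phi>(1)]) (use sub[OF J(2)] in auto)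
    then have "enat (T + gap) \<le> graph_dist (?G J' - ?F) (g s) (g t)"
      unfolding diff[OF J(2) F(4)] using \<phi>(2) g(1) A by (intro graph_dist_ge) auto
    then have 2: "ereal (real (T + gap)) \<le> ereal_of_enat (graph_dist (?G J' - ?F) (g s) (g t))"
      by (metis ereal_of_enat_le_iff ereal_of_enat_simps(1))
    have "?q \<le> ereal_of_enat (graph_dist (?G J - ?F) (g s) (g t)) + ereal \<beta>"
      using answer[OF J(1) F(3)] by (rule conjunct2)
    also have "\<dots> \<le> ereal (real T) + ereal \<beta>" using 1 by (rule add_right_mono)
    also have "\<dots> < ereal (real (T + gap))" using \<open>\<beta> < real gap\<close> by simp
    also note 2
    also have "ereal_of_enat (graph_dist (?G J' - ?F) (g s) (g t)) \<le> ?q"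
      unfolding eq using answer[OF J(2) F(4)] by (rule conjunct1)
    finally show False by simp
  qed
  have "inj_on ?c (Pow I)"
  proof (rule inj_onI)
    fix J J' assume "J \<in> Pow I" "J' \<in> Pow I" "?c J = ?c J'"
    then show "J = J'" using contra[of J J'] contra[of J' J] by auto
  qed
  then show ?thesis
    by (rule card_le_if_inj_bool_lists[OF _ \<open>finite I\<close>])
      (rule length_le_worst_case_bits[OF G st])
qed

section \<open>Selecting a terminal by edge faults\<close>

text \<open>A graph hung on the root \<open>r\<close>: for every index \<open>q\<close> at most \<open>f\<close> faults make the leaf of \<open>q\<close> closer
  to \<open>r\<close> than every other leaf, by a margin of \<open>cap\<close>. Asking for the potential instead of
  distances bounds detours through whatever is attached to the leaves; its values at all the
  other leaves agree, so that it can be extended to the attached graph.\<close>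

definition selector ::
  "'a set \<Rightarrow> 'a set set \<Rightarrow> 'a \<Rightarrow> ('i \<Rightarrow> 'a) \<Rightarrow> 'i set \<Rightarrow> nat \<Rightarrow> nat \<Rightarrow> nat \<Rightarrow> bool" where
  "selector A E r leaf I f cap Dm \<longleftrightarrow>
     finite A \<and> r \<in> A \<and> leaf ` I \<subseteq> A \<and> (\<forall>e\<in>E. \<exists>u\<in>A. \<exists>v\<in>A. u \<noteq> v \<and> e = {u, v}) \<and>
     (\<forall>q\<in>I. \<exists>F D \<phi>. F \<subseteq> E \<and> finite F \<and> card F \<le> f \<and> D \<le> Dm \<and>
        (r, leaf q) \<in> adj (E - F) ^^ D \<and> potential (E - F) \<phi> \<and>
        \<phi> r = 0 \<and> \<phi> (leaf q) = int D \<and> (\<forall>q'\<in>I - {q}. \<phi> (leaf q') = int (D + cap)))"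

lemma selector_edge:
  assumes "selector A E r leaf I f cap Dm" "e \<in> E"
  obtains u v where "u \<in> A" "v \<in> A" "u \<noteq> v" "e = {u, v}"
proof -
  have "\<exists>u\<in>A. \<exists>v\<in>A. u \<noteq> v \<and> e = {u, v}" using assms by (simp add: selector_def)
  with that show ?thesis by blast
qed

lemma selector_query:
  assumes "selector A E r leaf I f cap Dm" "q \<in> I"
  obtains F D \<phi> where "F \<subseteq> E" "finite F" "card F \<le> f" "D \<le> Dm"
    "(r, leaf q) \<in> adj (E - F) ^^ D" "potential (E - F) \<phi>"
    "\<phi> r = 0" "\<phi> (leaf q) = int D" "\<forall>q'\<in>I - {q}. \<phi> (leaf q') = int (D + cap)"
proof -
  have "\<exists>F D \<phi>. F \<subseteq> E \<and> finite F \<and> card F \<le> f \<and> D \<le> Dm \<and>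
        (r, leaf q) \<in> adj (E - F) ^^ D \<and> potential (E - F) \<phi> \<and>
        \<phi> r = 0 \<and> \<phi> (leaf q) = int D \<and> (\<forall>q'\<in>I - {q}. \<phi> (leaf q') = int (D + cap))"
    using assms by (simp only: selector_def)
  then show ?thesis by (elim exE conjE) (rule that)
qed

lemma selector_reindex:
  assumes "selector A E r leaf I f cap Dm" "inj_on h I'" "h ` I' \<subseteq> I"
  shows "selector A E r (\<lambda>q. leaf (h q)) I' f cap Dm"
  unfolding selector_def
proof (intro conjI ballI)
  fix q assume q: "q \<in> I'"
  then have "h q \<in> I" using assms by auto
  from selector_query[OF assms(1) this] obtain F D \<phi>
    where *: "F \<subseteq> E" "finite F" "card F \<le> f" "D \<le> Dm" "(r, leaf (h q)) \<in> adj (E - F) ^^ D"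
      "potential (E - F) \<phi>" "\<phi> r = 0" "\<phi> (leaf (h q)) = int D"
      and leaf: "\<forall>q'\<in>I - {h q}. \<phi> (leaf q') = int (D + cap)" by metis
  have "\<forall>q'\<in>I' - {q}. \<phi> (leaf (h q')) = int (D + cap)"
  proof
    fix q' assume "q' \<in> I' - {q}"
    then have "h q' \<in> I - {h q}" using assms q by (auto simp: inj_on_eq_iff)
    then show "\<phi> (leaf (h q')) = int (D + cap)" using leaf by simp
  qed
  with * show "\<exists>F D \<phi>. F \<subseteq> E \<and> finite F \<and> card F \<le> f \<and> D \<le> Dm \<and>
        (r, leaf (h q)) \<in> adj (E - F) ^^ D \<and> potential (E - F) \<phi> \<and>
        \<phi> r = 0 \<and> \<phi> (leaf (h q)) = int D \<and>
        (\<forall>q'\<in>I' - {q}. \<phi> (leaf (h q')) = int (D + cap))"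
    by (intro exI conjI)
qed (use assms in \<open>auto simp: selector_def\<close>)

definition comb_edges :: "nat \<Rightarrow> nat \<Rightarrow> (nat \<times> nat) set set" where
  "comb_edges K c = {{(q, 0), (Suc q, 0)} | q. Suc q < K} \<union>
     {{(q, j), (q, Suc j)} | q j. q < K \<and> j < (K - q) * c}"

text \<open>Tooth \<open>q\<close> is shorter than all the teeth before it, and cutting the spine after \<open>q\<close> makes it
  the shortest that can be reached.\<close>

lemma selector_comb:
  assumes "K > 0"
  shows "selector ({..<K} \<times> {..K * Suc cap}) (comb_edges K (Suc cap)) (0, 0)
           (\<lambda>q. (q, (K - q) * Suc cap)) {..<K} 1 cap (K * Suc cap)"
  unfolding selector_def
proof (intro conjI ballI)
  let ?E = "comb_edges K (Suc cap)" and ?len = "\<lambda>q. (K - q) * Suc cap"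
  have len: "?len q \<le> K * Suc cap" for q by (intro mult_le_mono1) simp
  show "(\<lambda>q. (q, ?len q)) ` {..<K} \<subseteq> {..<K} \<times> {..K * Suc cap}"
    using len by (auto simp del: mult_Suc_right)
  fix e assume "e \<in> ?E"
  then have "(\<exists>q. e = {(q, 0), (Suc q, 0)} \<and> Suc q < K) \<or>
      (\<exists>q j. e = {(q, j), (q, Suc j)} \<and> q < K \<and> j < ?len q)"
    by (simp only: comb_edges_def Un_iff mem_Collect_eq)
  then consider q where "Suc q < K" "e = {(q, 0), (Suc q, 0)}"
    | q j where "q < K" "j < ?len q" "e = {(q, j), (q, Suc j)}"
    by (elim disjE exE conjE) iprover+
  then show "\<exists>u\<in>{..<K} \<times> {..K * Suc cap}. \<exists>v\<in>{..<K} \<times> {..K * Suc cap}. u \<noteq> v \<and> e = {u, v}"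
  proof cases
    case 1
    then show ?thesis by - (rule bexI[of _ "(q, 0)"], rule bexI[of _ "(Suc q, 0)"], auto)
  next
    case 2
    then have "Suc j \<le> K * Suc cap" using len[of q] by linarith
    with 2 show ?thesis by - (rule bexI[of _ "(q, j)"], rule bexI[of _ "(q, Suc j)"], auto)
  qed
next
  let ?E = "comb_edges K (Suc cap)" and ?len = "\<lambda>q. (K - q) * Suc cap"
  fix q assume "q \<in> {..<K}"
  then have q: "q < K" by simp
  \<comment> \<open>No spine edge follows the last tooth; the intersection then leaves
    \<open>F\<close> empty.\<close>
  define F where "F = {{(q, 0), (Suc q, 0 :: nat)}} \<inter> ?E"
  define D where "D = q + ?len q"
  \<comment> \<open>Distance from the root truncated at \<open>D + cap\<close>. The part beyond the
    cut is disconnected from the root and may take that constant value.\<close>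
  define \<phi> where "\<phi> = (\<lambda>(q', j). int (if q' \<le> q then min (q' + j) (D + cap) else D + cap))"
  have "D \<le> q * Suc cap + ?len q" unfolding D_def by simp
  also have "\<dots> = K * Suc cap" using q by (metis add_mult_distrib le_add_diff_inverse less_imp_le)
  finally have D: "D \<le> K * Suc cap" .
  have "((0, 0), (q, 0)) \<in> adj (?E - F) ^^ q"
    by (rule walk_fun[where f = "\<lambda>i. (i, 0)"])
      (use q in \<open>auto simp: adj_def comb_edges_def F_def doubleton_eq_iff\<close>)
  moreover have "((q, 0), (q, ?len q)) \<in> adj (?E - F) ^^ ?len q"
  proof (rule walk_fun[where f = "\<lambda>i. (q, i)"])
    fix j assume j: "j < ?len q"
    then have "{(q, j), (q, Suc j)} \<in> ?E" using q unfolding comb_edges_def by blast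
    then show "((q, j), (q, Suc j)) \<in> adj (?E - F)"
      by (auto simp: adj_def F_def doubleton_eq_iff)
  qed
  ultimately have walk: "((0, 0), (q, ?len q)) \<in> adj (?E - F) ^^ D"
    unfolding D_def by (rule walk_trans)
  have pot: "potential (?E - F) \<phi>"
  proof (rule potentialI)
    fix e assume e: "e \<in> ?E - F"
    then have "(\<exists>q. e = {(q, 0), (Suc q, 0)} \<and> Suc q < K) \<or>
        (\<exists>q j. e = {(q, j), (q, Suc j)} \<and> q < K \<and> j < ?len q)"
      by (simp only: comb_edges_def Un_iff mem_Collect_eq Diff_iff)
    then consider q' where "e = {(q', 0), (Suc q', 0)}" | q' j where "e = {(q', j), (q', Suc j)}"
      by (elim disjE exE conjE) iprover+
    then show "\<exists>u v. e = {u, v} \<and> \<bar>\<phi> u - \<phi> v\<bar> \<le> 1"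
    proof cases
      case 1
      then have "q' \<noteq> q" using e by (auto simp: F_def)
      then show ?thesis using 1
        by - (rule exI[of _ "(q', 0)"], rule exI[of _ "(Suc q', 0)"], auto simp: \<phi>_def)
    next
      case 2
      then show ?thesis by - (rule exI[of _ "(q', j)"], rule exI[of _ "(q', Suc j)"], auto simp: \<phi>_def)
    qed
  qed
  have leaf: "\<phi> (q', ?len q') = int (D + cap)" if "q' \<in> {..<K} - {q}" for q'
  proof (cases "q' < q")
    case True
    then obtain d where d: "q = q' + Suc d" using less_iff_Suc_add by auto
    obtain m where m: "K = q + m" using q by (metis less_imp_le le_Suc_ex)
    \<comment> \<open>Each tooth further back saves one spine edge but costs \<open>Suc cap\<close>
      tooth edges, so one tooth back already yields the margin \<open>cap\<close>.\<close>
    have "D + cap \<le> q' + ?len q'"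
      unfolding D_def m d by (simp add: algebra_simps)
    then show ?thesis using True by (simp add: \<phi>_def)
  qed (use that in \<open>auto simp: \<phi>_def\<close>)
  show "\<exists>F D \<phi>. F \<subseteq> ?E \<and> finite F \<and> card F \<le> 1 \<and> D \<le> K * Suc cap \<and>
      ((0, 0), (q, ?len q)) \<in> adj (?E - F) ^^ D \<and> potential (?E - F) \<phi> \<and>
      \<phi> (0, 0) = 0 \<and> \<phi> (q, ?len q) = int D \<and>
      (\<forall>q'\<in>{..<K} - {q}. \<phi> (q', ?len q') = int (D + cap))"
  proof (intro exI[of _ F] exI[of _ D] exI[of _ \<phi>] conjI ballI)
    show "card F \<le> 1" unfolding F_def
      using card_mono[of "{{(q, 0), (Suc q, 0 :: nat)}}"] by (metis Int_lower1 card.empty card_insert_disjoint empty_iff finite.emptyI finite_insert One_nat_def)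
    show "\<phi> (q, ?len q) = int D" by (simp add: \<phi>_def D_def)
  qed (use walk pot leaf D in \<open>auto simp: F_def \<phi>_def\<close>)
qed (use assms in auto)

text \<open>The outer margin pays for the deepest inner detour, so no fault-free inner copy is preferred.\<close>

lemma selector_compose:
  fixes A :: "'a set" and B :: "'b set" and I :: "'i set" and J :: "'j set"
  assumes A: "selector A EA ra la I fa capA DA" and B: "selector B EB rb lb J fb capB DB"
    and capA: "capA = DB + Suc capB" and "finite I"
  shows "selector (A <+> I \<times> B)
     ((`) Inl ` EA \<union> (\<Union>q\<in>I. insert {Inl (la q), Inr (q, rb)} ((`) (\<lambda>b. Inr (q, b)) ` EB)))
     (Inl ra) (\<lambda>(q, q'). Inr (q, lb q')) (I \<times> J) (fa + fb) capB (Suc (DA + DB))"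
    (is "selector ?V ?E ?r ?l ?I ?f capB ?D")
  unfolding selector_def
proof (intro conjI ballI)
  show "finite ?V" using A B \<open>finite I\<close> by (auto simp: selector_def)
  show "?r \<in> ?V" "?l ` ?I \<subseteq> ?V" using A B by (auto simp: selector_def)
next
  fix e assume "e \<in> ?E"
  then consider e' where "e' \<in> EA" "e = Inl ` e'" | q where "q \<in> I" "e = {Inl (la q), Inr (q, rb)}"
    | q e' where "q \<in> I" "e' \<in> EB" "e = (\<lambda>b. Inr (q, b)) ` e'" by blast
  then show "\<exists>u\<in>?V. \<exists>v\<in>?V. u \<noteq> v \<and> e = {u, v}"
  proof cases
    case 1
    then obtain u v where "u \<in> A" "v \<in> A" "u \<noteq> v" "e' = {u, v}" using selector_edge[OF A] by metis
    then show ?thesis using 1 by - (rule bexI[of _ "Inl u"], rule bexI[of _ "Inl v"], auto)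
  next
    case 2
    then show ?thesis using A B
      by - (rule bexI[of _ "Inl (la q)"], rule bexI[of _ "Inr (q, rb)"], auto simp: selector_def)
  next
    case 3
    then obtain u v where "u \<in> B" "v \<in> B" "u \<noteq> v" "e' = {u, v}" using selector_edge[OF B] by metis
    then show ?thesis using 3 by - (rule bexI[of _ "Inr (q, u)"], rule bexI[of _ "Inr (q, v)"], auto)
  qed
next
  fix qq assume "qq \<in> ?I"
  then obtain q q' where qq: "qq = (q, q')" "q \<in> I" "q' \<in> J" by blast
  obtain F1 D1 \<phi>1 where 1: "F1 \<subseteq> EA" "finite F1" "card F1 \<le> fa" "D1 \<le> DA"
        "(ra, la q) \<in> adj (EA - F1) ^^ D1" "potential (EA - F1) \<phi>1"
        "\<phi>1 ra = 0" "\<phi>1 (la q) = int D1" "\<forall>q'\<in>I - {q}. \<phi>1 (la q') = int (D1 + capA)"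
    by (rule selector_query[OF A \<open>q \<in> I\<close>])
  obtain F2 D2 \<phi>2 where 2: "F2 \<subseteq> EB" "finite F2" "card F2 \<le> fb" "D2 \<le> DB"
        "(rb, lb q') \<in> adj (EB - F2) ^^ D2" "potential (EB - F2) \<phi>2"
        "\<phi>2 rb = 0" "\<phi>2 (lb q') = int D2" "\<forall>q''\<in>J - {q'}. \<phi>2 (lb q'') = int (D2 + capB)"
    by (rule selector_query[OF B \<open>q' \<in> J\<close>])
  define in_copy where "in_copy = (\<lambda>b. Inr (q, b) :: 'a + 'i \<times> 'b)"
  define F where "F = (`) Inl ` F1 \<union> (`) in_copy ` F2"
  \<comment> \<open>\<open>T\<close> is the common value of all wrong leaves. Other copies are
    constantly \<open>T\<close>, and the outer potential is truncated there; at a wrong outer leaf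
    it reaches \<open>T\<close> because \<open>D2 \<le> DB\<close> and
    \<open>capA = DB + Suc capB\<close>.\<close>
  define T where "T = int (D1 + 1 + D2 + capB)"
  define \<phi> where "\<phi> = (\<lambda>v. case v of Inl a \<Rightarrow> min (\<phi>1 a) T
      | Inr (p, b) \<Rightarrow> if p = q then int (D1 + 1) + \<phi>2 b else T)"
  have inj: "inj ((`) (Inl :: 'a \<Rightarrow> 'a + 'i \<times> 'b))" "inj ((`) in_copy)"
    by (rule inj_on_image, simp add: inj_on_def in_copy_def)+
  have copy: "(`) in_copy ` EB \<subseteq> ?E" using \<open>q \<in> I\<close> unfolding in_copy_def by blast
  then have "F \<subseteq> ?E" unfolding F_def using image_mono[OF 1(1), of "(`) Inl"] image_mono[OF 2(1), of "(`) in_copy"]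
    by (intro Un_least) (auto simp del: Un_iff intro: subset_trans)
  have disj: "Inl ` e \<noteq> in_copy ` e'" if "e \<in> EA" for e e'
  proof -
    have "e \<noteq> {}" using selector_edge[OF A that] by blast
    then show ?thesis by (auto simp: in_copy_def)
  qed
  have cardF: "card F \<le> fa + fb" unfolding F_def
    using card_Un_le[of "(`) Inl ` F1" "(`) in_copy ` F2"]
      card_image_le[OF \<open>finite F1\<close>, of "(`) Inl :: _ \<Rightarrow> ('a + 'i \<times> 'b) set"]
      card_image_le[OF \<open>finite F2\<close>, of "(`) in_copy"] \<open>card F1 \<le> fa\<close> \<open>card F2 \<le> fb\<close> by linarith
  have w1: "(`) Inl ` (EA - F1) \<subseteq> ?E - F"
  proof
    fix e :: "('a + 'i \<times> 'b) set" assume "e \<in> (`) Inl ` (EA - F1)"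
    then obtain e' where e': "e = Inl ` e'" "e' \<in> EA" "e' \<notin> F1" by blast
    then have "e \<notin> (`) Inl ` F1" using inj_image_mem_iff[OF inj(1)] by simp
    moreover have "e \<notin> (`) in_copy ` F2" using disj[OF e'(2)] e'(1) by (metis imageE)
    moreover have "e \<in> ?E" using e'(1,2) by (simp only: Un_iff) (rule disjI1, rule imageI)
    ultimately show "e \<in> ?E - F" unfolding F_def by (simp only: Diff_iff Un_iff) simp
  qed
  have w2: "(`) in_copy ` (EB - F2) \<subseteq> ?E - F"
  proof
    fix e assume "e \<in> (`) in_copy ` (EB - F2)"
    then obtain e' where e': "e = in_copy ` e'" "e' \<in> EB" "e' \<notin> F2" by blast
    then have "e \<notin> (`) in_copy ` F2" using inj_image_mem_iff[OF inj(2)] by simp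
    moreover have "e \<notin> (`) Inl ` F1" using disj \<open>F1 \<subseteq> EA\<close> e'(1) by (metis imageE subsetD)
    moreover have "e \<in> ?E" unfolding e'(1) by (rule subsetD[OF copy imageI[OF e'(2)]])
    ultimately show "e \<in> ?E - F" unfolding F_def by (simp only: Diff_iff Un_iff) simp
  qed
  have w3: "(Inl (la q), in_copy rb) \<in> adj (?E - F)"
  proof -
    have "{Inl (la q), in_copy rb} \<notin> F" unfolding F_def in_copy_def by blast
    then show ?thesis using \<open>q \<in> I\<close> unfolding adj_def in_copy_def by blast
  qed
  have "(Inl ra, in_copy (lb q')) \<in> adj (?E - F) ^^ (Suc D1 + D2)"
    by (rule walk_trans[OF walk_step[OF walk_image[OF 1(5) w1] w3] walk_image[OF 2(5) w2]])
  then have walk: "(Inl ra, Inr (q, lb q')) \<in> adj (?E - F) ^^ Suc (D1 + D2)"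
    by (simp add: in_copy_def)
  have pot: "potential (?E - F) \<phi>"
  proof (rule potentialI)
    fix e assume e: "e \<in> ?E - F"
    then consider e' where "e' \<in> EA" "e = Inl ` e'" | p where "p \<in> I" "e = {Inl (la p), Inr (p, rb)}"
      | p e' where "p \<in> I" "e' \<in> EB" "e = (\<lambda>b. Inr (p, b)) ` e'" by blast
    then show "\<exists>u v. e = {u, v} \<and> \<bar>\<phi> u - \<phi> v\<bar> \<le> 1"
    proof cases
      case 1
      then obtain u v where uv: "e' = {u, v}" using selector_edge[OF A] by metis
      have "e' \<in> EA - F1" using e 1 unfolding F_def by blast
      then have "\<bar>\<phi>1 u - \<phi>1 v\<bar> \<le> 1" using potentialD \<open>potential (EA - F1) \<phi>1\<close> uv by metis
      then have "\<bar>\<phi> (Inl u) - \<phi> (Inl v)\<bar> \<le> 1" by (auto simp: \<phi>_def)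
      then show ?thesis using 1 uv by - (rule exI[of _ "Inl u"], rule exI[of _ "Inl v"], auto)
    next
      case 2
      have "\<bar>\<phi> (Inl (la p)) - \<phi> (Inr (p, rb))\<bar> \<le> 1"
        using 1 \<open>\<phi>2 rb = 0\<close> capA \<open>D2 \<le> DB\<close> \<open>p \<in> I\<close> by (cases "p = q") (auto simp: \<phi>_def T_def)
      then show ?thesis using 2 by blast
    next
      case 3
      then obtain u v where uv: "e' = {u, v}" using selector_edge[OF B] by metis
      have "\<bar>\<phi> (Inr (p, u)) - \<phi> (Inr (p, v))\<bar> \<le> 1"
      proof (cases "p = q")
        case True
        then have "e' \<in> EB - F2" using e 3 unfolding F_def in_copy_def by blast
        then have "\<bar>\<phi>2 u - \<phi>2 v\<bar> \<le> 1" using potentialD \<open>potential (EB - F2) \<phi>2\<close> uv by metis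
        then show ?thesis by (auto simp: \<phi>_def)
      qed (auto simp: \<phi>_def)
      then show ?thesis using 3 uv by - (rule exI[of _ "Inr (p, u)"], rule exI[of _ "Inr (p, v)"], auto)
    qed
  qed
  have leaf: "\<phi> (?l p) = int (Suc (D1 + D2) + capB)" if "p \<in> ?I - {qq}" for p
    using that qq 2 by (auto simp: \<phi>_def T_def split: if_splits)
  show "\<exists>F D \<phi>. F \<subseteq> ?E \<and> finite F \<and> card F \<le> ?f \<and> D \<le> ?D \<and>
      (?r, ?l qq) \<in> adj (?E - F) ^^ D \<and> potential (?E - F) \<phi> \<and>
      \<phi> ?r = 0 \<and> \<phi> (?l qq) = int D \<and> (\<forall>q'\<in>?I - {qq}. \<phi> (?l q') = int (D + capB))"
  proof (intro exI[of _ F] exI[of _ "Suc (D1 + D2)"] exI[of _ \<phi>] conjI ballI)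
    show "finite F" unfolding F_def using 1 2 by simp
    show "\<phi> ?r = 0" using 1 by (simp add: \<phi>_def T_def)
    show "\<phi> (?l qq) = int (Suc (D1 + D2))" using 2 qq by (simp add: \<phi>_def)
    show "(?r, ?l qq) \<in> adj (?E - F) ^^ Suc (D1 + D2)" using walk qq by simp
    show "Suc (D1 + D2) \<le> ?D" using 1(4) 2(4) by simp
  qed (fact pot leaf \<open>F \<subseteq> ?E\<close> cardF)+
qed

section \<open>Private turns on layered paths\<close>

datatype ('a, 'b, 'v, 'q) vertex = Src 'a | Snk 'b | Mid nat 'v 'q nat

text \<open>Layer \<open>i\<close> has an edge labelled \<open>u\<close> from \<open>z\<close> to \<open>step i u z\<close>. The set \<open>off \<pi> i\<close> contains the nodes
  of layer \<open>i\<close> that forward moves reach by leaving \<open>\<pi>\<close>; it is closed under forward moves and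
  misses \<open>\<pi>\<close>, so \<open>\<pi>\<close> is the only forward path between its ends. The extreme values of \<open>off\<close> are
  conventions that give all wrong terminals the same potential.\<close>

locale layered_paths =
  fixes l :: nat and V :: "'v set" and Q :: "'q set" and X :: "'v set"
    and step :: "nat \<Rightarrow> 'q \<Rightarrow> 'v \<Rightarrow> 'v" and I :: "'i set"
    and node :: "'i \<Rightarrow> nat \<Rightarrow> 'v" and lab :: "'i \<Rightarrow> nat \<Rightarrow> 'q" and off :: "'i \<Rightarrow> nat \<Rightarrow> 'v set"
  assumes l_pos: "0 < l" and finite_V: "finite V" and finite_Q: "finite Q" and finite_I: "finite I"
    and X_V: "X \<subseteq> V"
    and node_0: "\<pi> \<in> I \<Longrightarrow> node \<pi> 0 \<in> X"
    and node_V: "\<pi> \<in> I \<Longrightarrow> i \<le> l \<Longrightarrow> node \<pi> i \<in> V"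
    and lab_Q: "\<pi> \<in> I \<Longrightarrow> i < l \<Longrightarrow> lab \<pi> i \<in> Q"
    and node_Suc: "\<pi> \<in> I \<Longrightarrow> i < l \<Longrightarrow> node \<pi> (Suc i) = step i (lab \<pi> i) (node \<pi> i)"
    and inj_step: "step i u z = step i u z' \<Longrightarrow> z = z'"
    and turn_determines: "\<pi> \<in> I \<Longrightarrow> \<pi>' \<in> I \<Longrightarrow> Suc i < l \<Longrightarrow> node \<pi> i = node \<pi>' i \<Longrightarrow>
      lab \<pi> i = lab \<pi>' i \<Longrightarrow> lab \<pi> (Suc i) = lab \<pi>' (Suc i) \<Longrightarrow> \<pi> = \<pi>'"
    and off_node: "\<pi> \<in> I \<Longrightarrow> i \<le> l \<Longrightarrow> node \<pi> i \<notin> off \<pi> i"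
    and off_deviate: "\<pi> \<in> I \<Longrightarrow> i < l \<Longrightarrow> u \<in> Q \<Longrightarrow> u \<noteq> lab \<pi> i \<Longrightarrow>
      step i u (node \<pi> i) \<in> off \<pi> (Suc i)"
    and off_step: "\<pi> \<in> I \<Longrightarrow> i < l \<Longrightarrow> u \<in> Q \<Longrightarrow> z \<in> off \<pi> i \<Longrightarrow> step i u z \<in> off \<pi> (Suc i)"
    and off_0: "off \<pi> 0 = {}"
    and off_l: "z \<noteq> node \<pi> l \<Longrightarrow> z \<in> off \<pi> l"

text \<open>The margins are those that the potential in \<open>separation\<close> needs: a wrong
  start lies \<open>2 * l\<close> above the right one, and a wrong end lies below the right one by
  the total gain \<open>2 * l - 2\<close> along \<open>\<pi>\<close>.\<close>

locale layered_oracle_graph = layered_paths l V Q X step I node lab off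
  for l :: nat and V :: "'v set" and Q :: "'q set" and X :: "'v set"
    and step :: "nat \<Rightarrow> 'q \<Rightarrow> 'v \<Rightarrow> 'v" and I :: "'i set"
    and node :: "'i \<Rightarrow> nat \<Rightarrow> 'v" and lab :: "'i \<Rightarrow> nat \<Rightarrow> 'q" and off :: "'i \<Rightarrow> nat \<Rightarrow> 'v set" +
  fixes A :: "'a set" and EA ra la fa DA and B :: "'b set" and EB rb lb fb DB
  assumes selA: "selector A EA ra la X fa (2 * l) DA"
    and selB: "selector B EB rb lb V fb (2 * l - 2) DB"
begin

text \<open>An edge \<open>(i, z, u)\<close> of the layered graph becomes the path \<open>Mid i z u 0, \<dots>, Mid i z u l\<close>, and
  a node becomes the bipartite graph of turns between its incoming and outgoing edges. The turns
  of \<open>\<pi>\<close> belong to no other path, and they are present iff \<open>\<pi> \<in> J\<close>.\<close>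

inductive arc :: "'i set \<Rightarrow> ('a, 'b, 'v, 'q) vertex \<Rightarrow> ('a, 'b, 'v, 'q) vertex \<Rightarrow> bool" for J where
  arc_src: "{a, a'} \<in> EA \<Longrightarrow> arc J (Src a) (Src a')"
| arc_snk: "{b, b'} \<in> EB \<Longrightarrow> arc J (Snk b) (Snk b')"
| arc_in: "x \<in> X \<Longrightarrow> u \<in> Q \<Longrightarrow> arc J (Src (la x)) (Mid 0 x u 0)"
| arc_mid: "i < l \<Longrightarrow> z \<in> V \<Longrightarrow> u \<in> Q \<Longrightarrow> j < l \<Longrightarrow> arc J (Mid i z u j) (Mid i z u (Suc j))"
| arc_turn: "Suc i < l \<Longrightarrow> z \<in> V \<Longrightarrow> u \<in> Q \<Longrightarrow> u' \<in> Q \<Longrightarrow> step i u z \<in> V \<Longrightarrow>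
    \<forall>\<pi>\<in>I - J. \<not> (z = node \<pi> i \<and> u = lab \<pi> i \<and> u' = lab \<pi> (Suc i)) \<Longrightarrow>
    arc J (Mid i z u l) (Mid (Suc i) (step i u z) u' 0)"
| arc_out: "Suc i = l \<Longrightarrow> z \<in> V \<Longrightarrow> u \<in> Q \<Longrightarrow> step i u z \<in> V \<Longrightarrow>
    arc J (Mid i z u l) (Snk (lb (step i u z)))"

section \<open>Vertices and edges of the oracle graph\<close>

definition edges :: "'i set \<Rightarrow> ('a, 'b, 'v, 'q) vertex set set" where
  "edges J = {{u, v} | u v. arc J u v}"

definition verts :: "('a, 'b, 'v, 'q) vertex set" where
  "verts = Src ` A \<union> Snk ` B \<union> (\<lambda>(i, z, u, j). Mid i z u j) ` ({..<l} \<times> V \<times> Q \<times> {..l})"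

lemma mem_verts [simp]:
  "Src a \<in> verts \<longleftrightarrow> a \<in> A" "Snk b \<in> verts \<longleftrightarrow> b \<in> B"
  "Mid i z u j \<in> verts \<longleftrightarrow> i < l \<and> z \<in> V \<and> u \<in> Q \<and> j \<le> l"
  by (auto simp: verts_def image_iff)

lemma finite_verts: "finite verts"
  using selA selB finite_V finite_Q by (auto simp: verts_def selector_def)

lemma card_verts: "card verts \<le> card A + card B + l * card V * card Q * Suc l"
proof -
  have "finite A" "finite B" using selA selB by (auto simp: selector_def)
  have "card ((\<lambda>(i, z, u, j). Mid i z u j) ` ({..<l} \<times> V \<times> Q \<times> {..l}) :: ('a, 'b, 'v, 'q) vertex set)
      \<le> card ({..<l} \<times> V \<times> Q \<times> {..l})"
    by (rule card_image_le) (use finite_V finite_Q in auto)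
  also have "\<dots> = l * card V * card Q * Suc l" by (simp add: card_cartesian_product algebra_simps)
  finally show ?thesis unfolding verts_def
    using card_image_le[OF \<open>finite A\<close>, of "Src :: 'a \<Rightarrow> ('a, 'b, 'v, 'q) vertex"]
      card_image_le[OF \<open>finite B\<close>, of "Snk :: 'b \<Rightarrow> ('a, 'b, 'v, 'q) vertex"]
      card_Un_le[of "Src ` A" "Snk ` B :: ('a, 'b, 'v, 'q) vertex set"]
      card_Un_le[of "Src ` A \<union> Snk ` B" "(\<lambda>(i, z, u, j). Mid i z u j) ` ({..<l} \<times> V \<times> Q \<times> {..l})"]
    by linarith
qed

lemma src_ends:
  assumes "{a, a'} \<in> EA" shows "a \<in> A" "a' \<in> A" "a \<noteq> a'"
  using selector_edge[OF selA assms] by (metis doubleton_eq_iff)+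

lemma snk_ends:
  assumes "{b, b'} \<in> EB" shows "b \<in> B" "b' \<in> B" "b \<noteq> b'"
  using selector_edge[OF selB assms] by (metis doubleton_eq_iff)+

lemma arc_verts: "arc J u v \<Longrightarrow> u \<in> verts \<and> v \<in> verts \<and> u \<noteq> v"
proof (induction rule: arc.induct)
  case (arc_in x u)
  then show ?case using selA X_V l_pos by (auto simp: selector_def)
next
  case (arc_out i z u)
  then show ?case using selB by (auto simp: selector_def)
qed (use src_ends snk_ends in auto)

lemma edges_verts: "e \<in> edges J \<Longrightarrow> \<exists>u\<in>verts. \<exists>v\<in>verts. u \<noteq> v \<and> e = {u, v}"
  unfolding edges_def using arc_verts by blast

lemma Src_edges: "(`) Src ` EA \<subseteq> edges J"
proof
  fix e :: "('a, 'b, 'v, 'q) vertex set" assume "e \<in> (`) Src ` EA"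
  then obtain e' where e': "e = Src ` e'" "e' \<in> EA" by blast
  with selector_edge[OF selA] obtain a a' where "e' = {a, a'}" by metis
  with e' show "e \<in> edges J" unfolding edges_def using arc_src[of a a' J] by auto
qed

lemma Snk_edges: "(`) Snk ` EB \<subseteq> edges J"
proof
  fix e :: "('a, 'b, 'v, 'q) vertex set" assume "e \<in> (`) Snk ` EB"
  then obtain e' where e': "e = Snk ` e'" "e' \<in> EB" by blast
  with selector_edge[OF selB] obtain b b' where "e' = {b, b'}" by metis
  with e' show "e \<in> edges J" unfolding edges_def using arc_snk[of b b' J] by auto
qed

context
  fixes \<pi> assumes \<pi>: "\<pi> \<in> I"
begin

text \<open>A potential for \<open>J\<close> with \<open>\<pi> \<notin> J\<close>: it gains 2 at every inner node of \<open>\<pi>\<close>, where the missing turn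
  must be replaced by three others. Nodes of \<open>off\<close> gain nothing. The remaining nodes off \<open>\<pi>\<close> can
  be reached only by a step back, which costs more than all those gains together.\<close>

definition base :: "nat \<Rightarrow> int" where
  "base i = int (i * Suc l) + 1"

text \<open>\<open>out_val\<close> and \<open>in_val\<close> are the values at the first and last
  vertex of a subdivided edge. At \<open>i = 0\<close> the truncated \<open>i - 1\<close> gives all
  edges out of the right start the same value, since no turn is made there.\<close>

definition out_val :: "nat \<Rightarrow> 'v \<Rightarrow> 'q \<Rightarrow> int" where
  "out_val i z u = base i +
     (if z = node \<pi> i then (if u = lab \<pi> i then 2 * int i else 2 * int (i - 1))
      else if z \<in> off \<pi> i then 0 else 2 * int l)"

definition in_val :: "nat \<Rightarrow> 'v \<Rightarrow> 'q \<Rightarrow> int" where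
  "in_val i z u = base (Suc i) - 1 +
     (if step i u z = node \<pi> (Suc i) then (if u = lab \<pi> i then 2 * int i else 2 * int i + 2)
      else if step i u z \<in> off \<pi> (Suc i) then 0 else 2 * int l)"

lemma base_Suc: "base (Suc i) = base i + int l + 1"
  by (simp add: base_def)

text \<open>This is why edges have length \<open>l\<close>: along a forward edge the bonus over
  \<open>base\<close> never rises and falls by at most \<open>2 * l\<close>, while
  \<open>base\<close> contributes \<open>l\<close>, so the change stays between \<open>- l\<close>
  and \<open>l\<close>.\<close>

lemma in_val_out_val:
  assumes "i < l" "u \<in> Q"
  shows "\<bar>in_val i z u - out_val i z u\<bar> \<le> int l"
proof (cases "z = node \<pi> i")
  case True
  show ?thesis
  proof (cases "u = lab \<pi> i")
    case True
    then show ?thesis using \<open>z = node \<pi> i\<close> node_Suc[OF \<pi>] assms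
      by (simp add: in_val_def out_val_def base_Suc)
  next
    case False
    then have "step i u z \<in> off \<pi> (Suc i)" using off_deviate[OF \<pi>] assms True by simp
    moreover have "step i u z \<noteq> node \<pi> (Suc i)" using calculation off_node[OF \<pi>, of "Suc i"] assms by auto
    ultimately show ?thesis using False True assms by (simp add: in_val_def out_val_def base_Suc)
  qed
next
  case z: False
  show ?thesis
  proof (cases "z \<in> off \<pi> i")
    case True
    then have "step i u z \<in> off \<pi> (Suc i)" using off_step[OF \<pi>] assms by simp
    moreover have "step i u z \<noteq> node \<pi> (Suc i)" using calculation off_node[OF \<pi>, of "Suc i"] assms by auto
    ultimately show ?thesis using z True assms by (simp add: in_val_def out_val_def base_Suc)
  next
    case False
    have "u \<noteq> lab \<pi> i" if "step i u z = node \<pi> (Suc i)"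
      using that node_Suc[OF \<pi>] assms z inj_step by metis
    then show ?thesis using z False assms by (auto simp: in_val_def out_val_def base_Suc)
  qed
qed

text \<open>The potentials of the selectors and of the layered part fit together at every terminal.
  The one of the sinks enters negatively, since that selector is traversed from leaf to
  root.\<close>

lemma separation:
  assumes "\<pi> \<notin> J"
    and A: "potential (EA - FA) \<phi>A" "\<phi>A (la (node \<pi> 0)) = int Da"
      "\<forall>x\<in>X - {node \<pi> 0}. \<phi>A (la x) = int (Da + 2 * l)"
    and B: "potential (EB - FB) \<phi>B" "\<phi>B (lb (node \<pi> l)) = int Db"
      "\<forall>y\<in>V - {node \<pi> l}. \<phi>B (lb y) = int (Db + (2 * l - 2))"
  shows "\<exists>\<phi>. potential (edges J - ((`) Src ` FA \<union> (`) Snk ` FB)) \<phi> \<and>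
    (\<forall>a. \<phi> (Src a) = \<phi>A a) \<and> (\<forall>b. \<phi> (Snk b) = int (Da + (l * Suc l + 1) + 2 * (l - 1) + Db) - \<phi>B b)"
proof -
  define val where "val i z u j = int Da + min (out_val i z u + int j) (in_val i z u + (int l - int j))" for i z u j
  define \<phi> where "\<phi> v = (case v of Src a \<Rightarrow> \<phi>A a
      | Snk b \<Rightarrow> int Da + base l + int (2 * l - 2) + int Db - \<phi>B b
      | Mid i z u j \<Rightarrow> val i z u j)" for v
  have start: "val i z u 0 = int Da + out_val i z u" and stop: "val i z u l = int Da + in_val i z u"
    if "i < l" "u \<in> Q" for i z u
    using in_val_out_val[OF that, of z] by (auto simp: val_def)
  have "potential (edges J - ((`) Src ` FA \<union> (`) Snk ` FB)) \<phi>"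
  proof (rule potentialI)
    fix e assume e: "e \<in> edges J - ((`) Src ` FA \<union> (`) Snk ` FB)"
    then obtain v w where vw: "e = {v, w}" "arc J v w" unfolding edges_def by blast
    from vw(2) e[unfolded vw(1)] have "\<bar>\<phi> v - \<phi> w\<bar> \<le> 1"
    proof cases
      case (arc_src a a')
      then have "{a, a'} \<in> EA - FA" using e vw image_eqI[of "{v, w}" "(`) Src" "{a, a'}" FA] by auto
      then show ?thesis using potentialD[OF A(1)] arc_src by (simp add: \<phi>_def)
    next
      case (arc_snk b b')
      then have "{b, b'} \<in> EB - FB" using e vw image_eqI[of "{v, w}" "(`) Snk" "{b, b'}" FB] by auto
      then have "\<bar>\<phi>B b - \<phi>B b'\<bar> \<le> 1" by (rule potentialD[OF B(1)])
      then show ?thesis using arc_snk by (simp add: \<phi>_def)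
    next
      case (arc_in x u)
      then show ?thesis using start[of 0 u x] l_pos A off_0 by (auto simp: \<phi>_def out_val_def base_def)
    next
      case (arc_mid i z u j)
      then show ?thesis by (simp add: \<phi>_def val_def)
    next
      case (arc_turn i z u u')
      have "\<not> (z = node \<pi> i \<and> u = lab \<pi> i \<and> u' = lab \<pi> (Suc i))" using arc_turn assms(1) \<pi> by blast
      moreover have "z = node \<pi> i" if "u = lab \<pi> i" "step i u z = node \<pi> (Suc i)"
        using that node_Suc[OF \<pi>, of i] arc_turn inj_step by (metis Suc_lessD)
      \<comment> \<open>At a node of \<open>\<pi>\<close>, only the turn from its incoming to its
        outgoing edge would jump by 3, and that turn is absent; every other combination differs by
        1.\<close>
      ultimately have "\<bar>in_val i z u - out_val (Suc i) (step i u z) u'\<bar> \<le> 1"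
        by (auto simp: in_val_def out_val_def)
      then show ?thesis using start[of "Suc i" u' "step i u z"] stop[of i u z] arc_turn
        by (simp add: \<phi>_def)
    next
      case (arc_out i z u)
      then show ?thesis using stop[of i u z] off_l[of "step i u z" \<pi>] B l_pos
        by (cases "step i u z = node \<pi> l") (auto simp: \<phi>_def in_val_def of_nat_diff)
    qed
    then show "\<exists>v w. e = {v, w} \<and> \<bar>\<phi> v - \<phi> w\<bar> \<le> 1" using vw by blast
  qed
  moreover have "int (l * Suc l) + 1 = base l" by (simp add: base_def)
  ultimately show ?thesis
    by (intro exI[of _ \<phi>]) (auto simp: \<phi>_def base_def diff_mult_distrib2)
qed

text \<open>The length counts \<open>l\<close> subdivided edges of length \<open>l\<close>,
  \<open>l - 1\<close> turns and one edge to each selector. By \<open>turn_determines\<close>,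
  omitting other paths removes no turn of \<open>\<pi>\<close>.\<close>

lemma path_walk:
  assumes "\<pi> \<in> J" and F: "\<And>i z u j e. Mid i z u j \<in> e \<Longrightarrow> e \<notin> F"
  shows "(Src (la (node \<pi> 0)), Snk (lb (node \<pi> l))) \<in> adj (edges J - F) ^^ (l * Suc l + 1)"
proof -
  define R where "R = adj (edges J - F)"
  have R: "(v, w) \<in> R" if "arc J v w" "(\<exists>i z u j. v = Mid i z u j) \<or> (\<exists>i z u j. w = Mid i z u j)" for v w
  proof -
    have "{v, w} \<in> edges J" using that unfolding edges_def by blast
    moreover have "{v, w} \<notin> F" using that(2) F by (metis insert_iff)
    ultimately show ?thesis by (auto simp: R_def adj_def)
  qed
  let ?M = "\<lambda>i. Mid i (node \<pi> i) (lab \<pi> i)"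
  have seg: "(?M i 0, ?M i l) \<in> R ^^ l" if "i < l" for i
    by (rule walk_fun) (intro R arc_mid, use that \<pi> node_V lab_Q in auto)
  have "(Src (la (node \<pi> 0)), ?M i l) \<in> R ^^ (1 + Suc i * l + i)" if "i < l" for i
    using that
  proof (induction i)
    case 0
    have "(Src (la (node \<pi> 0)), ?M 0 0) \<in> R ^^ 1"
      using R[OF arc_in[of "node \<pi> 0" "lab \<pi> 0" J]] \<pi> node_0 lab_Q l_pos by auto
    from walk_trans[OF this seg[OF 0]] show ?case by simp
  next
    case (Suc i)
    have "(?M i l, ?M (Suc i) 0) \<in> R"
    proof (intro R)
      have "\<forall>\<pi>'\<in>I - J. \<not> (node \<pi> i = node \<pi>' i \<and> lab \<pi> i = lab \<pi>' i \<and> lab \<pi> (Suc i) = lab \<pi>' (Suc i))"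
        using turn_determines[OF \<pi> _ Suc.prems] \<open>\<pi> \<in> J\<close> by auto
      then show "arc J (?M i l) (?M (Suc i) 0)"
        using arc_turn[of i "node \<pi> i" "lab \<pi> i" "lab \<pi> (Suc i)" J] Suc.prems node_Suc[OF \<pi>, of i] \<pi>
          node_V[OF \<pi>, of i] node_V[OF \<pi>, of "Suc i"] lab_Q[OF \<pi>, of i] lab_Q[OF \<pi>, of "Suc i"] by simp
    qed auto
    with Suc have "(Src (la (node \<pi> 0)), ?M (Suc i) 0) \<in> R ^^ Suc (1 + Suc i * l + i)"
      by (intro walk_step) auto
    from walk_trans[OF this seg[OF Suc.prems]] show ?case by (simp add: algebra_simps)
  qed
  from this[of "l - 1"] have *: "(Src (la (node \<pi> 0)), ?M (l - 1) l) \<in> R ^^ (l * Suc l)"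
    using l_pos by (cases l) (auto simp: algebra_simps)
  have "(?M (l - 1) l, Snk (lb (node \<pi> l))) \<in> R"
    using R[OF arc_out[of "l - 1" "node \<pi> (l - 1)" "lab \<pi> (l - 1)" J]] l_pos
      node_V[OF \<pi>, of "l - 1"] node_V[OF \<pi>, of l] lab_Q[OF \<pi>, of "l - 1"] node_Suc[OF \<pi>, of "l - 1"] by auto
  with * show ?thesis unfolding R_def[symmetric] by (simp del: mult_Suc_right) (rule relcompI)
qed

end

text \<open>All faults lie in the two selectors, which are the same for every \<open>J\<close>;
  hence \<open>F\<close> and \<open>T\<close> do not depend on \<open>J\<close>.\<close>

lemma fault_query:
  assumes "\<pi> \<in> I"
  shows "\<exists>F T. card F \<le> fa + fb \<and> finite F \<and> (\<forall>J\<subseteq>I. F \<subseteq> edges J \<and>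
        (\<pi> \<in> J \<longrightarrow> (Src ra, Snk rb) \<in> adj (edges J - F) ^^ T) \<and>
        (\<pi> \<notin> J \<longrightarrow> (\<exists>\<phi>. potential (edges J - F) \<phi> \<and> \<phi> (Src ra) + int (T + 2 * (l - 1)) \<le> \<phi> (Snk rb))))"
proof -
  from selector_query[OF selA node_0[OF assms]] obtain FA Da \<phi>A where
    FA: "FA \<subseteq> EA" "finite FA" "card FA \<le> fa" and A: "(ra, la (node \<pi> 0)) \<in> adj (EA - FA) ^^ Da"
      "potential (EA - FA) \<phi>A" "\<phi>A ra = 0" "\<phi>A (la (node \<pi> 0)) = int Da"
      "\<forall>x\<in>X - {node \<pi> 0}. \<phi>A (la x) = int (Da + 2 * l)" by metis
  from selector_query[OF selB node_V[OF assms order_refl]] obtain FB Db \<phi>B where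
    FB: "FB \<subseteq> EB" "finite FB" "card FB \<le> fb" and B: "(rb, lb (node \<pi> l)) \<in> adj (EB - FB) ^^ Db"
      "potential (EB - FB) \<phi>B" "\<phi>B rb = 0" "\<phi>B (lb (node \<pi> l)) = int Db"
      "\<forall>y\<in>V - {node \<pi> l}. \<phi>B (lb y) = int (Db + (2 * l - 2))" by metis
  define F :: "('a, 'b, 'v, 'q) vertex set set" where "F = (`) Src ` FA \<union> (`) Snk ` FB"
  have inj: "inj ((`) (Src :: 'a \<Rightarrow> ('a, 'b, 'v, 'q) vertex))" "inj ((`) (Snk :: 'b \<Rightarrow> ('a, 'b, 'v, 'q) vertex))"
    by (rule inj_on_image, simp add: inj_on_def)+
  have "card F \<le> fa + fb"
    using card_Un_le[of "(`) Src ` FA" "(`) Snk ` FB :: ('a, 'b, 'v, 'q) vertex set set"]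
      card_image_le[OF FA(2), of "(`) Src :: _ \<Rightarrow> ('a, 'b, 'v, 'q) vertex set"]
      card_image_le[OF FB(2), of "(`) Snk :: _ \<Rightarrow> ('a, 'b, 'v, 'q) vertex set"] FA(3) FB(3)
    unfolding F_def by linarith
  have "finite F" using FA FB by (simp add: F_def)
  have F_edges: "F \<subseteq> edges J" for J
    unfolding F_def using Src_edges[of J] Snk_edges[of J] image_mono[OF FA(1)] image_mono[OF FB(1)]
    by (meson Un_least subset_trans)
  have Src_not: "Src ` e \<notin> (`) Snk ` FB" if "e \<in> EA" for e
    using selector_edge[OF selA that] by auto
  have Snk_not: "Snk ` e \<notin> (`) Src ` FA" if "e \<in> EB" for e
    using selector_edge[OF selB that] by auto
  have wA: "(`) Src ` (EA - FA) \<subseteq> edges J - F" for J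
  proof
    fix e :: "('a, 'b, 'v, 'q) vertex set" assume "e \<in> (`) Src ` (EA - FA)"
    then obtain e' where e': "e = Src ` e'" "e' \<in> EA" "e' \<notin> FA" by blast
    then have "e \<notin> F" using inj_image_mem_iff[OF inj(1)] Src_not[OF e'(2)] by (simp add: F_def)
    moreover have "e \<in> edges J" unfolding e'(1) by (rule subsetD[OF Src_edges imageI[OF e'(2)]])
    ultimately show "e \<in> edges J - F" by simp
  qed
  have wB: "(`) Snk ` (EB - FB) \<subseteq> edges J - F" for J
  proof
    fix e :: "('a, 'b, 'v, 'q) vertex set" assume "e \<in> (`) Snk ` (EB - FB)"
    then obtain e' where e': "e = Snk ` e'" "e' \<in> EB" "e' \<notin> FB" by blast
    then have "e \<notin> F" using inj_image_mem_iff[OF inj(2)] Snk_not[OF e'(2)] by (simp add: F_def)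
    moreover have "e \<in> edges J" unfolding e'(1) by (rule subsetD[OF Snk_edges imageI[OF e'(2)]])
    ultimately show "e \<in> edges J - F" by simp
  qed
  have Mid_F: "e \<notin> F" if "Mid i z u j \<in> e" for i z u j e
    using that unfolding F_def by auto
  let ?T = "Da + (l * Suc l + 1) + Db"
  have up: "(Src ra, Snk rb) \<in> adj (edges J - F) ^^ ?T" if "\<pi> \<in> J" for J
    by (rule walk_trans[OF walk_trans[OF walk_image[OF A(1) wA]
      path_walk[OF assms that Mid_F]] walk_rev[OF walk_image[OF B(1) wB]]])
  have lo: "\<exists>\<phi>. potential (edges J - F) \<phi> \<and> \<phi> (Src ra) + int (?T + 2 * (l - 1)) \<le> \<phi> (Snk rb)"
    if "\<pi> \<notin> J" for J
  proof -
    from separation[OF assms that A(2,4,5) B(2,4,5)] obtain \<phi> where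
      "potential (edges J - F) \<phi>" "\<forall>a. \<phi> (Src a) = \<phi>A a"
      "\<forall>b. \<phi> (Snk b) = int (Da + (l * Suc l + 1) + 2 * (l - 1) + Db) - \<phi>B b"
      unfolding F_def by blast
    then show ?thesis using A(3) B(3) by (intro exI[of _ \<phi>] conjI) simp_all
  qed
  show ?thesis using \<open>card F \<le> fa + fb\<close> \<open>finite F\<close> F_edges up lo by blast
qed

theorem card_le_bits:
  assumes "additive_FT_DSO n (fa + fb) \<beta> D" "\<beta> < real (2 * (l - 1))"
    "card A + card B + l * card V * card Q * Suc l \<le> n"
  shows "card I \<le> worst_case_bits n D"
proof (rule card_le_worst_case_bits[OF assms(1,2) finite_verts _ _ _ edges_verts finite_I fault_query])
  show "card verts \<le> n" using card_verts assms(3) by linarith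
  show "Src ra \<in> verts" "Snk rb \<in> verts" using selA selB by (auto simp: selector_def)
qed

end

section \<open>Convexly independent directions\<close>

text \<open>A direction \<open>u\<close> moves along the point \<open>(u, |u|\<^sup>2)\<close> of a paraboloid, and \<open>score v\<close> is the linear
  functional that has its unique maximum on the paraboloid at \<open>v\<close>.\<close>

type_synonym 'k site = "('k \<Rightarrow> nat) \<times> nat"

definition shift :: "('k::finite \<Rightarrow> nat) \<Rightarrow> 'k site \<Rightarrow> 'k site" where
  "shift u a = (\<lambda>k. fst a k + u k, snd a + (\<Sum>k\<in>UNIV. (u k)\<^sup>2))"

definition score :: "('k::finite \<Rightarrow> nat) \<Rightarrow> 'k site \<Rightarrow> int" where
  "score v a = 2 * (\<Sum>k\<in>UNIV. int (v k) * int (fst a k)) - int (snd a)"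

text \<open>Completing the square: the shift by \<open>u\<close> falls short of the best gain by the
  squared distance of \<open>u\<close> and \<open>v\<close>.\<close>

lemma score_shift:
  "score v (shift u a) = score v a + (\<Sum>k\<in>UNIV. (int (v k))\<^sup>2) - (\<Sum>k\<in>UNIV. (int (v k) - int (u k))\<^sup>2)"
  by (simp add: score_def shift_def sum.distrib sum_subtractf sum_distrib_left power2_eq_square algebra_simps)

lemma score_shift_less:
  assumes "u \<noteq> v"
  shows "score v (shift u a) < score v (shift v a)"
proof -
  obtain k where "u k \<noteq> v k" using assms by blast
  then have "0 < (\<Sum>k\<in>UNIV. (int (v k) - int (u k))\<^sup>2)"
    by (intro sum_pos2[of _ k]) auto
  then show ?thesis by (simp add: score_shift)
qed

lemma score_shift_le: "score v (shift u a) - score v a \<le> score v (shift v b) - score v b"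
  using sum_nonneg[of UNIV "\<lambda>k. (int (v k) - int (u k))\<^sup>2"] by (simp add: score_shift)

lemma inj_shift: "inj (shift u)"
  by (auto simp: inj_def shift_def fun_eq_iff prod_eq_iff)

lemma shift_funpow: "(shift u ^^ m) a = (\<lambda>k. fst a k + m * u k, snd a + m * (\<Sum>k\<in>UNIV. (u k)\<^sup>2))"
  by (induction m) (auto simp: shift_def algebra_simps)

section \<open>Boxes that contain the shifted sites\<close>

definition cube :: "nat \<Rightarrow> ('k::finite \<Rightarrow> nat) set" where
  "cube R = {u. \<forall>k. u k < R}"

lemma cube_eq_PiE: "cube R = PiE UNIV (\<lambda>_. {..<R})"
  by (auto simp: cube_def PiE_def extensional_def)

lemma finite_cube: "finite (cube R)"
  by (simp add: cube_eq_PiE finite_PiE)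

lemma card_cube: "card (cube R :: ('k::finite \<Rightarrow> nat) set) = R ^ CARD('k)"
  by (simp add: cube_eq_PiE card_PiE)

text \<open>Large enough for \<open>p\<close> shifts by vectors of \<open>cube R\<close> from a
  start in \<open>cube R\<close> at height 0. The paraboloid coordinate adds only 2 to the exponent
  of \<open>R\<close> in the size.\<close>

definition sites :: "nat \<Rightarrow> nat \<Rightarrow> 'k::finite site set" where
  "sites p R = cube (Suc p * R) \<times> {..p * CARD('k) * R\<^sup>2}"

lemma shift_funpow_sites:
  assumes "fst a \<in> cube R" "snd a = 0" "u \<in> cube R" "m \<le> p"
  shows "(shift u ^^ m) a \<in> sites p R"
proof -
  have "fst a k + m * u k < Suc p * R" for k
  proof -
    have "fst a k < R" "u k < R" using assms by (auto simp: cube_def)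
    then show ?thesis using mult_le_mono[OF assms(4), of "u k" R] by simp
  qed
  moreover have "m * (\<Sum>k\<in>UNIV. (u k)\<^sup>2) \<le> p * CARD('a) * R\<^sup>2"
  proof -
    have "(\<Sum>k\<in>UNIV. (u k)\<^sup>2) \<le> (\<Sum>k\<in>(UNIV :: 'a set). R\<^sup>2)"
      using assms by (intro sum_mono power_mono) (auto simp: cube_def less_imp_le)
    with assms(4) show ?thesis by (simp add: mult.assoc mult_le_mono)
  qed
  ultimately show ?thesis using assms(2) by (simp add: shift_funpow sites_def cube_def)
qed

text \<open>A path \<open>(x, v, w)\<close> starts at \<open>x\<close> and alternately moves the first site by \<open>v\<close> and the second by
  \<open>w\<close>; hence two consecutive labels and one node determine it.\<close>

type_synonym 'k node_pair = "'k site \<times> 'k site"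
type_synonym 'k path_code = "'k node_pair \<times> ('k \<Rightarrow> nat) \<times> ('k \<Rightarrow> nat)"

definition pair_step :: "nat \<Rightarrow> ('k::finite \<Rightarrow> nat) \<Rightarrow> 'k node_pair \<Rightarrow> 'k node_pair" where
  "pair_step i u z = (if even i then (shift u (fst z), snd z) else (fst z, shift u (snd z)))"

fun pair_label :: "'k path_code \<Rightarrow> nat \<Rightarrow> 'k \<Rightarrow> nat" where
  "pair_label (x, v, w) i = (if even i then v else w)"

fun pair_node :: "'k::finite path_code \<Rightarrow> nat \<Rightarrow> 'k node_pair" where
  "pair_node (x, v, w) i = ((shift v ^^ (Suc i div 2)) (fst x), (shift w ^^ (i div 2)) (snd x))"

fun pair_score :: "'k::finite path_code \<Rightarrow> 'k node_pair \<Rightarrow> int" where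
  "pair_score (x, v, w) z = score v (fst z) + score w (snd z)"

text \<open>A node behind \<open>\<pi>\<close> in score stays behind: leaving \<open>\<pi>\<close>
  loses score, and no label gains more than that of \<open>\<pi>\<close>.\<close>

definition pair_off :: "nat \<Rightarrow> 'k::finite path_code \<Rightarrow> nat \<Rightarrow> 'k node_pair set" where
  "pair_off l \<pi> i = (if i = 0 then {} else if i = l then - {pair_node \<pi> l}
     else {z. pair_score \<pi> z < pair_score \<pi> (pair_node \<pi> i)})"

lemma pair_node_Suc: "pair_node \<pi> (Suc i) = pair_step i (pair_label \<pi> i) (pair_node \<pi> i)"
  by (cases \<pi>) (auto simp: pair_step_def elim!: evenE oddE)

lemma pair_score_deviate:
  "u \<noteq> pair_label \<pi> i \<Longrightarrow> pair_score \<pi> (pair_step i u (pair_node \<pi> i)) < pair_score \<pi> (pair_node \<pi> (Suc i))"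
  unfolding pair_node_Suc by (cases \<pi>) (auto simp: pair_step_def score_shift_less simp del: pair_node.simps)

lemma pair_score_step:
  assumes "pair_score \<pi> z < pair_score \<pi> (pair_node \<pi> i)"
  shows "pair_score \<pi> (pair_step i u z) < pair_score \<pi> (pair_node \<pi> (Suc i))"
proof (cases \<pi>)
  case (fields x v w)
  let ?y = "pair_node \<pi> i"
  show ?thesis using assms score_shift_le[of v u "fst z" "fst ?y"] score_shift_le[of w u "snd z" "snd ?y"]
    unfolding pair_node_Suc by (auto simp: fields pair_step_def simp del: pair_node.simps)
qed

lemma mem_pair_off: "i < l \<Longrightarrow> pair_score \<pi> z < pair_score \<pi> (pair_node \<pi> (Suc i)) \<Longrightarrow> z \<in> pair_off l \<pi> (Suc i)"
  by (auto simp: pair_off_def)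

lemma pair_offD: "i < l \<Longrightarrow> z \<in> pair_off l \<pi> i \<Longrightarrow> pair_score \<pi> z < pair_score \<pi> (pair_node \<pi> i)"
  by (auto simp: pair_off_def split: if_splits)

lemma layered_paths_sites:
  fixes X :: "'k::finite node_pair set"
  assumes "p > 0" and X: "X \<subseteq> (cube R \<times> {0}) \<times> (cube R \<times> {0})"
  shows "layered_paths (2 * p) (sites p R \<times> sites p R) (cube R) X pair_step (X \<times> cube R \<times> cube R)
    pair_node pair_label (pair_off (2 * p))"
proof
  let ?V = "sites p R \<times> sites p R :: 'k node_pair set" and ?I = "X \<times> cube R \<times> cube R"
  show "0 < 2 * p" using assms by simp
  show fV: "finite ?V" by (simp add: sites_def finite_cube)
  show "finite (cube R)" by (rule finite_cube)
  have node: "pair_node \<pi> i \<in> ?V" if "\<pi> \<in> ?I" "i \<le> 2 * p" for \<pi> i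
  proof -
    obtain a b v w where \<pi>: "\<pi> = ((a, b), v, w)" by (metis prod.collapse)
    show ?thesis using that X unfolding \<pi>
      by (auto intro!: shift_funpow_sites)
  qed
  then show "pair_node \<pi> i \<in> ?V" if "\<pi> \<in> ?I" "i \<le> 2 * p" for \<pi> i using that .
  show XV: "X \<subseteq> ?V"
  proof
    fix x assume x: "x \<in> X"
    then have "fst (fst x) \<in> cube R" using X by auto
    with x node[of "(x, fst (fst x), fst (fst x))" 0] show "x \<in> ?V" by simp
  qed
  show "finite ?I" 
    using finite_subset[OF XV fV] by (intro finite_cartesian_product finite_cube)
  show "pair_node \<pi> 0 \<in> X" if "\<pi> \<in> ?I" for \<pi> using that by (cases \<pi>) simp
  show "pair_label \<pi> i \<in> cube R" if "\<pi> \<in> ?I" for \<pi> i using that by (cases \<pi>) simp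
  show "pair_node \<pi> (Suc i) = pair_step i (pair_label \<pi> i) (pair_node \<pi> i)" for \<pi> :: "'k path_code" and i by (rule pair_node_Suc)
  show "z = z'" if "pair_step i u z = pair_step i u z'" for i u and z z' :: "'k node_pair"
    using that by (cases z; cases z') (auto simp: pair_step_def inj_eq[OF inj_shift] split: if_splits)
  show "\<pi> = \<pi>'" if "pair_node \<pi> i = pair_node \<pi>' i" "pair_label \<pi> i = pair_label \<pi>' i" "pair_label \<pi> (Suc i) = pair_label \<pi>' (Suc i)"
    for \<pi> \<pi>' :: "'k path_code" and i
  proof -
    obtain a b v w where \<pi>: "\<pi> = ((a, b), v, w)" by (metis prod.collapse)
    obtain a' b' v' w' where \<pi>': "\<pi>' = ((a', b'), v', w')" by (metis prod.collapse)
    have "v = v'" "w = w'" using that(2,3) \<pi> \<pi>' by (auto split: if_splits)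
    with that(1) show ?thesis unfolding \<pi> \<pi>'
      by (auto simp: inj_eq[OF inj_fn[OF inj_shift]])
  qed
  show "pair_node \<pi> i \<notin> pair_off (2 * p) \<pi> i" for \<pi> :: "'k path_code" and i
    by (simp add: pair_off_def)
  show "pair_step i u (pair_node \<pi> i) \<in> pair_off (2 * p) \<pi> (Suc i)" if "i < 2 * p" "u \<noteq> pair_label \<pi> i"
    for \<pi> :: "'k path_code" and i u
    using that by (intro mem_pair_off pair_score_deviate)
  show "pair_step i u z \<in> pair_off (2 * p) \<pi> (Suc i)" if "i < 2 * p" "z \<in> pair_off (2 * p) \<pi> i"
    for \<pi> :: "'k path_code" and i u z
    using that pair_offD[OF that] by (intro mem_pair_off pair_score_step)
  show "pair_off (2 * p) \<pi> 0 = {}" for \<pi> :: "'k path_code" by (simp add: pair_off_def)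
  show "z \<in> pair_off (2 * p) \<pi> (2 * p)" if "z \<noteq> pair_node \<pi> (2 * p)" for \<pi> :: "'k path_code" and z
    using that \<open>p > 0\<close> by (simp add: pair_off_def)
qed

section \<open>Counting\<close>

text \<open>The size is quadratic because \<open>card X\<close> teeth have length up to
  \<open>card X * Suc cap\<close>.\<close>

lemma obtain_selector_1:
  assumes "finite X" "X \<noteq> {}"
  obtains A :: "(nat \<times> nat) set" and E r leaf Dm
  where "selector A E r leaf X 1 cap Dm" "card A \<le> card X ^ 2 * (cap + 2)"
proof -
  let ?K = "card X"
  have "?K > 0" using assms by (simp add: card_gt_0_iff)
  obtain h where h: "inj_on h X" "h ` X = {..<?K}"
    using ex_bij_betw_finite_nat[OF assms(1)] by (auto simp: bij_betw_def atLeast0LessThan)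
  have "card ({..<?K} \<times> {..?K * Suc cap}) \<le> ?K ^ 2 * (cap + 2)"
    using \<open>?K > 0\<close> by (simp add: card_cartesian_product power2_eq_square algebra_simps)
  then show ?thesis
    using that selector_reindex[OF selector_comb[OF \<open>?K > 0\<close>, of cap] h(1)] h(2) by blast
qed

text \<open>The outer margin must exceed the depth of an inner comb, so outer teeth have length
  about \<open>card S ^ 2\<close>; the \<open>card S\<close> inner combs have quadratic size. Both
  parts are cubic, for \<open>card S ^ 2\<close> terminals.\<close>

lemma obtain_selector_2:
  assumes "finite S" "S \<noteq> {}"
  obtains A :: "(nat \<times> nat + nat \<times> nat \<times> nat) set" and E r leaf Dm
  where "selector A E r leaf (S \<times> S) 2 cap Dm" "card A \<le> 3 * card S ^ 3 * (cap + 2)"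
proof -
  let ?K = "card S"
  have K: "?K > 0" using assms by (simp add: card_gt_0_iff)
  obtain h where h: "inj_on h S" "h ` S = {..<?K}"
    using ex_bij_betw_finite_nat[OF assms(1)] by (auto simp: bij_betw_def atLeast0LessThan)
  let ?c = "?K * Suc cap + Suc cap"
  let ?A = "{..<?K} \<times> {..?K * Suc ?c}" and ?B = "{..<?K} \<times> {..?K * Suc cap}"
  have "inj_on (map_prod h h) (S \<times> S)" "map_prod h h ` (S \<times> S) \<subseteq> {..<?K} \<times> {..<?K}"
    using h by (auto intro: map_prod_inj_on)
  from selector_reindex[OF selector_compose[OF selector_comb[OF K] selector_comb[OF K] refl finite_lessThan] this]
  obtain E r leaf Dm where "selector (?A <+> {..<?K} \<times> ?B) E r leaf (S \<times> S) (1 + 1) cap Dm"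
    by blast
  moreover have "card (?A <+> {..<?K} \<times> ?B) \<le> 3 * ?K ^ 3 * (cap + 2)"
  proof -
    have "card (?A <+> {..<?K} \<times> ?B) = ?K * Suc (?K * Suc ?c) + ?K * (?K * Suc (?K * Suc cap))"
      by (simp add: card_Plus card_cartesian_product)
    also have "\<dots> = ?K ^ 3 * (2 * cap + 2) + ?K ^ 2 * (cap + 3) + ?K"
      by (simp add: power2_eq_square power3_eq_cube algebra_simps)
    also have "\<dots> \<le> ?K ^ 3 * (2 * cap + 2) + ?K ^ 3 * (cap + 3) + ?K ^ 3"
      using K by (intro add_mono mult_le_mono1 power_increasing order_refl) (auto simp: self_le_power)
    also have "\<dots> = 3 * ?K ^ 3 * (cap + 2)" by (simp add: algebra_simps)
    finally show ?thesis .
  qed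
  ultimately show ?thesis using that by (metis one_add_one)
qed

text \<open>Up to factors of \<open>p\<close>, each of the three parts of the graph has at most
  \<open>K ^ 3\<close> vertices: the source selector by \<open>X_K\<close>, the sink selector for
  \<open>K ^ 2\<close> ends, and the layered part since \<open>cube R\<close> has at most
  \<open>K\<close> elements.\<close>

lemma sites_bits:
  fixes X :: "'k::finite node_pair set"
  assumes "p > 0" "X \<noteq> {}" and X: "X \<subseteq> (cube R \<times> {0}) \<times> (cube R \<times> {0})"
    and K: "K = card (sites p R :: 'k site set)" and X_K: "card X ^ 2 \<le> K ^ 3"
    and D: "additive_FT_DSO n 3 \<beta> D" and \<beta>: "\<beta> < real (2 * (2 * p - 1))" and n: "48 * K ^ 3 * p ^ 2 \<le> n"
  shows "card X * (R ^ CARD('k)) ^ 2 \<le> worst_case_bits n D"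
proof -
  let ?S = "sites p R :: 'k site set" and ?Q = "cube R :: ('k \<Rightarrow> nat) set" and ?l = "2 * p"
  interpret layered_paths ?l "?S \<times> ?S" ?Q X pair_step "X \<times> ?Q \<times> ?Q" pair_node pair_label "pair_off ?l"
    by (rule layered_paths_sites[OF assms(1) X])
  have S: "finite ?S" by (simp add: sites_def finite_cube)
  have "?S \<noteq> {}" using X_V \<open>X \<noteq> {}\<close> by auto
  have "finite X" by (rule finite_subset[OF X_V finite_V])
  obtain A :: "(nat \<times> nat) set" and EA ra la DA where
    A: "selector A EA ra la X 1 (2 * ?l) DA" "card A \<le> card X ^ 2 * (2 * ?l + 2)"
    by (rule obtain_selector_1[OF \<open>finite X\<close> \<open>X \<noteq> {}\<close>])
  obtain B :: "(nat \<times> nat + nat \<times> nat \<times> nat) set" and EB rb lb DB where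
    B: "selector B EB rb lb (?S \<times> ?S) 2 (2 * ?l - 2) DB" "card B \<le> 3 * K ^ 3 * (2 * ?l - 2 + 2)"
    unfolding K by (rule obtain_selector_2[OF S \<open>?S \<noteq> {}\<close>])
  interpret layered_oracle_graph ?l "?S \<times> ?S" ?Q X pair_step "X \<times> ?Q \<times> ?Q" pair_node pair_label "pair_off ?l"
    A EA ra la 1 DA B EB rb lb 2 DB
    by unfold_locales (fact A(1) B(1))+
  have "card ?Q \<le> K"
  proof -
    have "card ?Q \<le> card (cube (Suc p * R) :: ('k \<Rightarrow> nat) set)"
      by (rule card_mono[OF finite_cube]) (auto simp: cube_def intro: trans_less_add1)
    then show ?thesis unfolding K sites_def by (simp add: card_cartesian_product)
  qed
  have "card A + card B + ?l * card (?S \<times> ?S) * card ?Q * Suc ?l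
      \<le> K ^ 3 * (2 * ?l + 2) + 3 * K ^ 3 * (2 * ?l) + ?l * (K * K) * K * Suc ?l"
  proof (intro add_mono mult_le_mono1)
    show "card A \<le> K ^ 3 * (2 * ?l + 2)" using A(2) mult_le_mono1[OF X_K] order_trans by blast
    show "card B \<le> 3 * K ^ 3 * (2 * ?l)" 
    proof -
      have "2 * ?l - 2 + 2 = 2 * ?l" using \<open>p > 0\<close> by simp
      then show ?thesis using B(2) by simp
    qed
    show "?l * card (?S \<times> ?S) * card ?Q \<le> ?l * (K * K) * K"
      using \<open>card ?Q \<le> K\<close> unfolding card_cartesian_product K by (intro mult_le_mono order_refl)
  qed
  also have "\<dots> = K ^ 3 * (4 * p ^ 2 + 18 * p + 2)"
    by (simp add: power2_eq_square power3_eq_cube algebra_simps)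
  also have "\<dots> \<le> K ^ 3 * (48 * p ^ 2)"
  proof (rule mult_le_mono2)
    have "p \<le> p ^ 2" "1 \<le> p ^ 2" using \<open>p > 0\<close> by (auto simp: power2_eq_square)
    then show "4 * p ^ 2 + 18 * p + 2 \<le> 48 * p ^ 2" by linarith
  qed
  also have "\<dots> \<le> n" using n by (simp add: algebra_simps)
  finally have "card (X \<times> ?Q \<times> ?Q) \<le> worst_case_bits n D"
    by (intro card_le_bits[of n \<beta> D]) (use D \<beta> in \<open>simp_all add: numeral_3_eq_3\<close>)
  then show ?thesis by (simp add: card_cartesian_product card_cube power2_eq_square mult.assoc)
qed

text \<open>In dimension 16, \<open>K\<close> is \<open>R^18\<close> up to powers of \<open>p\<close>, so there are \<open>R^24 * R^32\<close> paths against
  about \<open>R^54\<close> vertices. The exponent 27 lets the surplus \<open>R^2\<close> beat the powers of \<open>p\<close>.\<close>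

lemma bits_at_scale:
  assumes "p > 0" and D: "additive_FT_DSO n 3 \<beta> D" "\<beta> < real (2 * (2 * p - 1))"
    and n: "48 * 17 ^ 3 * 2 ^ 48 * p ^ 1511 \<le> n"
  shows "p ^ 1512 \<le> worst_case_bits n D"
proof -
  define R where "R = p ^ 27"
  have "R > 0" using assms by (simp add: R_def)
  let ?Y = "(cube R \<times> {0}) \<times> (cube R \<times> {0}) :: 16 node_pair set"
  define K where "K = card (sites p R :: 16 site set)"
  have "card ?Y = R ^ 32" by (simp add: card_cartesian_product card_cube flip: power_add)
  moreover have "R ^ 24 \<le> R ^ 32" using \<open>R > 0\<close> by (intro power_increasing) auto
  \<comment> \<open>\<open>R ^ 24\<close> is the largest power of \<open>R\<close> whose square fits
    into \<open>(R ^ 16) ^ 3\<close>, a lower bound for \<open>K ^ 3\<close>.\<close>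
  ultimately obtain X where X: "X \<subseteq> ?Y" "card X = R ^ 24"
    by (metis obtain_subset_with_card_n)
  have "X \<noteq> {}" using X(2) \<open>R > 0\<close> by auto
  have K: "K = (Suc p * R) ^ 16 * Suc (p * 16 * R\<^sup>2)"
    unfolding K_def sites_def by (simp add: card_cartesian_product card_cube)
  have "R ^ 16 * 1 \<le> K" unfolding K by (intro mult_le_mono power_mono) auto
  then have "(R ^ 16) ^ 3 \<le> K ^ 3" by (intro power_mono) auto
  then have X_K: "card X ^ 2 \<le> K ^ 3" unfolding X(2) by (simp flip: power_mult)
  have "K \<le> (2 * p * R) ^ 16 * (17 * p * R ^ 2)"
    unfolding K
  proof (intro mult_le_mono power_mono)
    have "0 < p * R ^ 2" using \<open>p > 0\<close> \<open>R > 0\<close> by simp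
    then show "Suc (p * 16 * R\<^sup>2) \<le> 17 * p * R ^ 2" by linarith
  qed (use \<open>p > 0\<close> in auto)
  then have "K ^ 3 \<le> ((2 * p * R) ^ 16 * (17 * p * R ^ 2)) ^ 3" by (intro power_mono) auto
  also have "\<dots> = 17 ^ 3 * 2 ^ 48 * p ^ 51 * R ^ 54"
    by (simp add: power_mult_distrib ac_simps flip: power_mult power_add)
  finally have "48 * K ^ 3 * p ^ 2 \<le> 48 * (17 ^ 3 * 2 ^ 48 * p ^ 51 * R ^ 54) * p ^ 2"
    by (intro mult_le_mono) auto
  \<comment> \<open>With \<open>R = p ^ 27\<close> the exponents add up to 1511, one less than the
    \<open>27 * 56\<close> of the number of paths.\<close>
  also have "\<dots> = 48 * 17 ^ 3 * 2 ^ 48 * (p ^ 51 * p ^ 1458 * p ^ 2)"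
    unfolding R_def by (simp only: ac_simps flip: power_mult) simp
  also have "p ^ 51 * p ^ 1458 * p ^ 2 = p ^ 1511" by (simp flip: power_add)
  also note n
  finally have "card X * (R ^ CARD(16)) ^ 2 \<le> worst_case_bits n D"
    by (rule sites_bits[OF \<open>p > 0\<close> \<open>X \<noteq> {}\<close> X(1) K_def X_K D])
  then show ?thesis unfolding X(2) R_def by (simp flip: power_mult power_add)
qed

text \<open>Take the largest \<open>p\<close> with \<open>C * p ^ a \<le> n\<close>; its failure at
  \<open>p + 1 \<le> 2 * p\<close> bounds \<open>n\<close> above. The threshold on \<open>n\<close>
  makes \<open>C * 2 ^ a\<close> admissible, so that \<open>p\<close> can absorb this
  constant.\<close>

lemma polynomial_scale:
  fixes a C n :: nat
  assumes "a > 0" "C > 0" "C * (C * 2 ^ a) ^ a \<le> n"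
  obtains p where "C * 2 ^ a \<le> p" "C * p ^ a \<le> n" "n < C * 2 ^ a * p ^ a"
proof -
  let ?P = "\<lambda>p. C * p ^ a \<le> n"
  have bound: "p \<le> n" if "?P p" for p
  proof -
    have "p \<le> p ^ a" using self_le_power[of p a] \<open>a > 0\<close> by (cases "p = 0") auto
    also have "\<dots> \<le> C * p ^ a" using \<open>C > 0\<close> by simp
    finally show ?thesis using that by simp
  qed
  define p where "p = (GREATEST p. ?P p)"
  have p: "?P p" unfolding p_def by (rule GreatestI_nat[where P = ?P, OF assms(3)]) (use bound in blast)
  have le: "q \<le> p" if "?P q" for q unfolding p_def by (rule Greatest_le_nat[where P = ?P, OF that]) (use bound in blast)
  have "C * 2 ^ a \<le> p" using le assms(3) .
  then have "p > 0" using \<open>C > 0\<close> by (cases p) auto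
  have "n < C * Suc p ^ a" using le[of "Suc p"] by (metis not_le not_less_eq_eq order_refl)
  also have "\<dots> \<le> C * (2 * p) ^ a" using \<open>p > 0\<close> by (intro mult_le_mono power_mono) auto
  finally have "n < C * 2 ^ a * p ^ a" by (simp add: power_mult_distrib)
  with p \<open>C * 2 ^ a \<le> p\<close> show ?thesis using that by blast
qed

text \<open>At the scale \<open>p\<close> of \<open>n\<close>, \<open>n \<le> p ^ Suc a\<close>
  keeps the allowed error at most \<open>p\<close>, below the gap, while \<open>n\<close> is at most
  a constant times \<open>p ^ a\<close>, which turns \<open>p ^ Suc a\<close> bits into the exponent
  \<open>1 + 1 / a\<close>.\<close>

lemma superlinear_bits:
  assumes "a > 0" "C > 0"
    and bits: "\<And>p n \<beta> D. p > 0 \<Longrightarrow> additive_FT_DSO n f \<beta> D \<Longrightarrow> \<beta> < real (2 * (2 * p - 1)) \<Longrightarrow>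
      C * p ^ a \<le> n \<Longrightarrow> p ^ Suc a \<le> worst_case_bits n D"
    and D: "\<And>n. additive_FT_DSO n f (real n powr (1 / real (Suc a))) (D n)"
  shows "(\<lambda>n. real (worst_case_bits n (D n))) \<in> \<Omega>(\<lambda>n. real n powr (1 + 1 / real a))"
proof -
  define c where "c = real (C * 2 ^ a) powr (1 + 1 / real a)"
  have "c > 0" using \<open>C > 0\<close> by (simp add: c_def)
  have "1 / c * norm (real n powr (1 + 1 / real a)) \<le> norm (real (worst_case_bits n (D n)))"
    if n: "C * (C * 2 ^ a) ^ a \<le> n" for n
  proof -
    obtain p where p: "C * 2 ^ a \<le> p" "C * p ^ a \<le> n" "n < C * 2 ^ a * p ^ a"
      using polynomial_scale[OF assms(1,2) n] by metis
    have "p > 0" using p(1) \<open>C > 0\<close> by (cases p) auto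
    have "C * 2 ^ a * p ^ a \<le> p ^ Suc a" using p(1) by simp
    then have "real n \<le> real p ^ Suc a" using p(3) by (metis less_imp_le of_nat_le_iff of_nat_power order_trans)
    then have "real n powr (1 / real (Suc a)) \<le> (real p powr real (Suc a)) powr (1 / real (Suc a))"
      using \<open>p > 0\<close> by (intro powr_mono2) (auto simp only: powr_realpow of_nat_0_less_iff, auto)
    also have "\<dots> = real p" using \<open>p > 0\<close> by (simp add: powr_powr del: of_nat_Suc)
    also have "\<dots> < real (2 * (2 * p - 1))" using \<open>p > 0\<close> by linarith
    finally have wcb: "p ^ Suc a \<le> worst_case_bits n (D n)"
      by (rule bits[OF \<open>p > 0\<close> D _ p(2)])
    have "real n \<le> real (C * 2 ^ a) * real p powr real a"
      using p(3) \<open>p > 0\<close> by (simp add: powr_realpow flip: of_nat_power of_nat_mult)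
    then have "real n powr (1 + 1 / real a) \<le> (real (C * 2 ^ a) * real p powr real a) powr (1 + 1 / real a)"
      by (intro powr_mono2) auto
    also have "\<dots> = c * real p powr (real a * (1 + 1 / real a))"
      by (simp add: c_def powr_mult powr_powr)
    also have "real a * (1 + 1 / real a) = real (Suc a)" using \<open>a > 0\<close> by (simp add: field_simps)
    also have "real p powr real (Suc a) = real (p ^ Suc a)" using \<open>p > 0\<close> by (simp only: powr_realpow of_nat_0_less_iff of_nat_power)
    also have "\<dots> \<le> real (worst_case_bits n (D n))" using wcb by (simp only: of_nat_le_iff)
    finally show ?thesis using \<open>c > 0\<close> by (simp add: field_simps)
  qed
  then have "eventually (\<lambda>n. 1 / c * norm (real n powr (1 + 1 / real a)) \<le> norm (real (worst_case_bits n (D n)))) sequentially"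
    unfolding eventually_sequentially by blast
  then show ?thesis using \<open>c > 0\<close> by (intro landau_omega.bigI[of "1 / c"]) auto
qed

theorem theorem6:
  "\<exists>\<epsilon>>0. \<exists>\<delta>>0. \<forall>D :: nat \<Rightarrow> ft_dso.
     (\<forall>n. additive_FT_DSO n 3 (real n powr \<delta>) (D n)) \<longrightarrow>
     (\<lambda>n. real (worst_case_bits n (D n))) \<in> \<Omega>(\<lambda>n. real n powr (1 + \<epsilon>))"
proof (intro exI conjI allI impI)
  fix D :: "nat \<Rightarrow> ft_dso"
  \<comment> \<open>The witnesses \<open>\<epsilon> = 1 / 1511\<close> and
    \<open>\<delta> = 1 / 1512\<close> come from \<open>p ^ 1512\<close> bits on a constant times
    \<open>p ^ 1511\<close> vertices.\<close>
  assume D: "\<forall>n. additive_FT_DSO n 3 (real n powr (1 / real (Suc 1511))) (D n)"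
  show "(\<lambda>n. real (worst_case_bits n (D n))) \<in> \<Omega>(\<lambda>n. real n powr (1 + 1 / real 1511))"
  proof (rule superlinear_bits)
    show "p ^ Suc 1511 \<le> worst_case_bits n D"
      if "p > 0" "additive_FT_DSO n 3 \<beta> D" "\<beta> < real (2 * (2 * p - 1))" "48 * 17 ^ 3 * 2 ^ 48 * p ^ 1511 \<le> n"
      for p n \<beta> D
      using bits_at_scale[OF that] by (simp del: power_Suc)
  qed (use D in auto)
qed auto

end
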